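(* Let $n \geq 2$ be an integer and let $k$ be a field (finite or infinite). Then the monoid $T_n(k)$ of all $n\times n$ upper triangular matrices over $k$ divides the iterated wreath product $$\widetilde{k^{n-1}} \wr AS^*_{n-1}(k) \wr \widetilde{k^{n-2}} \wr AS^*_{n-2}(k) \wr \dots \wr \widetilde{k} \wr \left[ AS^*_1(k) \times T_1^*(k)^n \right] \wr U_1^n,$$ where $U_1$ is the two-element semilattice (viewed as a monoid). (For $n=2$ the product is $\widetilde{k}\wr[AS_1^*(k)\times T_1^*(k)^2]\wr U_1^2$.)
   Context: Functions are applied on the right of their arguments, and composition is accordingly left to right. Division: for semigroups $S,T$, $S$ divides $T$ (written $S\prec T$) if $S$ is a homomorphic image of a subsemigroup of $T$. Wreath product: for monoids $S$ and $T$, let $S^T$ be the monoid of all functions $T\to S$ under pointwise product, with left action of $T$ given by $t_2({}^{t_1}f)=(t_2t_1)f$. Then $S\wr T$ is the monoid with underlying set $S^T\times T$ and multiplication $(f,a)(g,b)=(f\,{}^{a}g,\,ab)$. Iterated wreath products are bracketed to the right: $S_m\wr S_{m-1}\wr\cdots\wr S_1 = S_m\wr(S_{m-1}\wr\cdots\wr S_1)$. Matrices: $T_n(k)$ is the monoid of all $n\times n$ upper triangular matrices over $k$ under matrix multiplication, and $T_1^*(k)$ is the multiplicative group of $k$ (the group of units of $T_1(k)$). Affine scaling: $k^m$ is the space of $1\times m$ row vectors. An affine scaling map of $k^m$ is a map $v\mapsto v\lambda+c$ with $\lambda\in k$, $c\in k^m$. The monoid of all such maps under composition is $AS_m(k)$,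 and $AS_m^*(k)$ is its group of units. For a set $X$, $\widetilde{X}$ is the monoid (under composition) consisting of the identity map on $X$ and all constant maps on $X$. Powers such as $T_1^*(k)^n$ and $U_1^n$ denote direct powers. *)

theory Defs
  imports "HOL-Algebra.Product_Groups" "Jordan_Normal_Form.Matrix"
begin

section \<open>Monoids of maps and of matrices\<close>

text \<open>Maps act on the right of their arguments, so the product of \<open>f\<close> and \<open>g\<close> is
  ``first \<open>f\<close>, then \<open>g\<close>''. A self-map of \<open>X\<close> is represented by the extensional function that
  agrees with it on \<open>X\<close>.\<close>

definition map_monoid :: "'a set \<Rightarrow> ('a \<Rightarrow> 'a) set \<Rightarrow> ('a \<Rightarrow> 'a) monoid" where
  "map_monoid X F =
     \<lparr>carrier = F, monoid.mult = (\<lambda>f g. compose X g f), one = (\<lambda>x\<in>X. x)\<rparr>"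

definition tilde :: "'a set \<Rightarrow> ('a \<Rightarrow> 'a) monoid" where
  "tilde X = map_monoid X (insert (\<lambda>x\<in>X. x) ((\<lambda>c. \<lambda>x\<in>X. c) ` X))"

definition affine_scaling :: "nat \<Rightarrow> ('k::field vec \<Rightarrow> 'k vec) monoid" where
  "affine_scaling m = map_monoid (carrier_vec m)
     {\<lambda>v\<in>carrier_vec m. l \<cdot>\<^sub>v v + c | l c. c \<in> carrier_vec m}"

definition upper_triangular_monoid :: "nat \<Rightarrow> 'k::field mat monoid" where
  "upper_triangular_monoid n =
     \<lparr>carrier = {A \<in> carrier_mat n n. upper_triangular A}, monoid.mult = (*), one = 1\<^sub>m n\<rparr>"

definition U1 :: "bool monoid" where
  "U1 = \<lparr>carrier = UNIV, monoid.mult = (\<and>), one = True\<rparr>"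

text \<open>The library's \<^const>\<open>product_group\<close> is the componentwise product and makes sense for monoids.\<close>

definition direct_power :: "'a monoid \<Rightarrow> nat \<Rightarrow> (nat \<Rightarrow> 'a) monoid" where
  "direct_power M n = product_group {..<n} (\<lambda>_. M)"


section \<open>Division\<close>

definition divides :: "'a monoid \<Rightarrow> 'b monoid \<Rightarrow> bool" where
  "divides S T \<longleftrightarrow>
     (\<exists>U \<subseteq> carrier T. (\<forall>x\<in>U. \<forall>y\<in>U. x \<otimes>\<^bsub>T\<^esub> y \<in> U) \<and> epi (T\<lparr>carrier := U\<rparr>) S \<noteq> {})"


section \<open>Wreath products\<close>

text \<open>The left action of \<open>a\<close> on \<open>g\<close> is the function \<open>t \<mapsto> g (t \<otimes> a)\<close>.\<close>

definition wreath :: "'a monoid \<Rightarrow> 'b monoid \<Rightarrow> (('b \<Rightarrow> 'a) \<times> 'b) monoid" where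
  "wreath S T =
     \<lparr>carrier = (carrier T \<rightarrow>\<^sub>E carrier S) \<times> carrier T,
      monoid.mult = (\<lambda>(f, a) (g, b).
        (\<lambda>t\<in>carrier T. f t \<otimes>\<^bsub>S\<^esub> g (t \<otimes>\<^bsub>T\<^esub> a), a \<otimes>\<^bsub>T\<^esub> b)),
      one = (\<lambda>t\<in>carrier T. \<one>\<^bsub>S\<^esub>, \<one>\<^bsub>T\<^esub>)\<rparr>"

text \<open>The type of \<^const>\<open>wreath\<close> grows with every application, and over an infinite field no HOL
  type accommodates \<open>S\<^sub>m \<wr> (\<dots> \<wr> (S\<^sub>1 \<wr> B))\<close> for all \<open>m\<close> at once. Therefore
  \<open>iterated_wreath [S\<^sub>m, \<dots>, S\<^sub>1] B W\<close> says that the monoid \<open>W\<close>, over an arbitrary type \<open>'w\<close>, is an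
  isomorphic copy of this right-bracketed product, the intermediate products being copied into the
  same type. The lemmas \<open>iterated_wreath_base\<close>, \<open>iterated_wreath_step\<close> and
  \<open>iterated_wreath_unique\<close> below show that such a copy exists over a suitable \<open>'w\<close> and is unique
  up to isomorphism, also across different types \<open>'w\<close>.\<close>

primrec iterated_wreath :: "'a monoid list \<Rightarrow> 'b monoid \<Rightarrow> 'w monoid \<Rightarrow> bool" where
  "iterated_wreath [] B W \<longleftrightarrow> monoid W \<and> W \<cong> B"
| "iterated_wreath (S # Ss) B W \<longleftrightarrow>
     monoid W \<and> (\<exists>V :: 'w monoid. iterated_wreath Ss B V \<and> W \<cong> wreath S V)"


subsection \<open>Existence and uniqueness of iterated wreath products\<close>

lemma is_iso_sym_closed:
  assumes "G \<cong> H" and closed: "\<And>x y. x \<in> carrier G \<Longrightarrow> y \<in> carrier G \<Longrightarrow> x \<otimes>\<^bsub>G\<^esub> y \<in> carrier G"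
  shows "H \<cong> G"
proof -
  obtain h where h: "h \<in> hom G H" "bij_betw h (carrier G) (carrier H)"
    using assms(1) by (auto simp: is_iso_def iso_def)
  let ?i = "inv_into (carrier G) h"
  have bij: "bij_betw ?i (carrier H) (carrier G)"
    using h(2) by (rule bij_betw_inv_into)
  have "?i (x \<otimes>\<^bsub>H\<^esub> y) = ?i x \<otimes>\<^bsub>G\<^esub> ?i y" if "x \<in> carrier H" "y \<in> carrier H" for x y
  proof -
    have mem: "?i x \<in> carrier G" "?i y \<in> carrier G"
      using bij that by (auto simp: bij_betw_def)
    have "h (?i x \<otimes>\<^bsub>G\<^esub> ?i y) = x \<otimes>\<^bsub>H\<^esub> y"
      using h mem that by (simp add: hom_def bij_betw_inv_into_right[OF h(2)])
    then show ?thesis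
      using bij_betw_inv_into_left[OF h(2) closed[OF mem]] by simp
  qed
  then have "?i \<in> hom H G"
    using bij by (auto simp: hom_def bij_betw_def)
  with bij show ?thesis
    by (auto simp: is_iso_def iso_def)
qed

lemma is_iso_sym:
  assumes "G \<cong> H" and "monoid G"
  shows "H \<cong> G"
  by (rule is_iso_sym_closed[OF assms(1)]) (rule monoid.m_closed[OF assms(2)])

lemma is_iso_refl: "G \<cong> G"
proof -
  have "(\<lambda>x. x) \<in> iso G G"
    by (auto simp: iso_def hom_def bij_betw_def inj_on_def)
  then show ?thesis
    by (auto simp: is_iso_def)
qed

lemma carrier_wreath: "carrier (wreath S T) = (carrier T \<rightarrow>\<^sub>E carrier S) \<times> carrier T"
  by (simp add: wreath_def)

lemma mult_wreath:
  "(f, a) \<otimes>\<^bsub>wreath S T\<^esub> (g, b) =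
     (\<lambda>t\<in>carrier T. f t \<otimes>\<^bsub>S\<^esub> g (t \<otimes>\<^bsub>T\<^esub> a), a \<otimes>\<^bsub>T\<^esub> b)"
  by (simp add: wreath_def)

lemma one_wreath: "\<one>\<^bsub>wreath S T\<^esub> = (\<lambda>t\<in>carrier T. \<one>\<^bsub>S\<^esub>, \<one>\<^bsub>T\<^esub>)"
  by (simp add: wreath_def)

lemma monoid_wreath:
  assumes "monoid S" and "monoid T"
  shows "monoid (wreath S T)"
proof -
  interpret S: monoid S by fact
  interpret T: monoid T by fact
  have E: "f t \<in> carrier S" if "f \<in> carrier T \<rightarrow>\<^sub>E carrier S" "t \<in> carrier T" for f t
    using that by (rule PiE_mem)
  show ?thesis
  proof (rule monoidI)
    fix x y assume "x \<in> carrier (wreath S T)" "y \<in> carrier (wreath S T)"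
    then show "x \<otimes>\<^bsub>wreath S T\<^esub> y \<in> carrier (wreath S T)"
      by (cases x, cases y) (simp add: carrier_wreath mult_wreath E)
  next
    show "\<one>\<^bsub>wreath S T\<^esub> \<in> carrier (wreath S T)"
      by (simp add: carrier_wreath one_wreath)
  next
    fix x y z
    assume "x \<in> carrier (wreath S T)" "y \<in> carrier (wreath S T)" "z \<in> carrier (wreath S T)"
    then show "x \<otimes>\<^bsub>wreath S T\<^esub> y \<otimes>\<^bsub>wreath S T\<^esub> z = x \<otimes>\<^bsub>wreath S T\<^esub> (y \<otimes>\<^bsub>wreath S T\<^esub> z)"
      by (cases x, cases y, cases z)
        (simp add: carrier_wreath mult_wreath E S.m_assoc T.m_assoc cong: restrict_cong)
  next
    fix x assume "x \<in> carrier (wreath S T)"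
    then obtain f a where x: "x = (f, a)" "f \<in> carrier T \<rightarrow>\<^sub>E carrier S" "a \<in> carrier T"
      by (auto simp: carrier_wreath)
    have "(\<lambda>t\<in>carrier T. \<one>\<^bsub>S\<^esub> \<otimes>\<^bsub>S\<^esub> f t) = f" "(\<lambda>t\<in>carrier T. f t \<otimes>\<^bsub>S\<^esub> \<one>\<^bsub>S\<^esub>) = f"
      using E[OF x(2)] PiE_arb[OF x(2)] by (auto simp: restrict_def)
    then show "\<one>\<^bsub>wreath S T\<^esub> \<otimes>\<^bsub>wreath S T\<^esub> x = x" "x \<otimes>\<^bsub>wreath S T\<^esub> \<one>\<^bsub>wreath S T\<^esub> = x"
      using x(3) by (simp_all add: x(1) mult_wreath one_wreath cong: restrict_cong)
  qed
qed

lemma wreath_cong: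
  assumes "T \<cong> T'" and T: "monoid T"
  shows "wreath S T \<cong> wreath S T'"
proof -
  obtain h where h: "h \<in> hom T T'" "bij_betw h (carrier T) (carrier T')"
    using assms(1) by (auto simp: is_iso_def iso_def)
  let ?i = "inv_into (carrier T) h"
  have bij: "bij_betw ?i (carrier T') (carrier T)"
    using h(2) by (rule bij_betw_inv_into)
  have i: "?i t \<in> carrier T" if "t \<in> carrier T'" for t
    using bij that by (auto simp: bij_betw_def)
  have hm: "h t \<in> carrier T'" if "t \<in> carrier T" for t
    using h(2) that by (auto simp: bij_betw_def)
  have hi: "h (?i t) = t" if "t \<in> carrier T'" for t
    using bij_betw_inv_into_right[OF h(2) that] .
  have ih: "?i (h t) = t" if "t \<in> carrier T" for t
    using bij_betw_inv_into_left[OF h(2) that] .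
  have hmult: "h (a \<otimes>\<^bsub>T\<^esub> b) = h a \<otimes>\<^bsub>T'\<^esub> h b" if "a \<in> carrier T" "b \<in> carrier T" for a b
    using h(1) that by (auto simp: hom_def)
  have clT: "a \<otimes>\<^bsub>T\<^esub> b \<in> carrier T" if "a \<in> carrier T" "b \<in> carrier T" for a b
    using monoid.m_closed[OF T that] .
  have clT': "a \<otimes>\<^bsub>T'\<^esub> b \<in> carrier T'" if "a \<in> carrier T'" "b \<in> carrier T'" for a b
    using hm[OF clT[OF i[OF that(1)] i[OF that(2)]]] hmult[OF i[OF that(1)] i[OF that(2)]] that
    by (simp add: hi)
  have imult: "?i (t \<otimes>\<^bsub>T'\<^esub> h a) = ?i t \<otimes>\<^bsub>T\<^esub> a" if "t \<in> carrier T'" "a \<in> carrier T" for t a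
    using ih[OF clT[OF i[OF that(1)] that(2)]] hmult[OF i[OF that(1)] that(2)] that
    by (simp add: hi)
  let ?F = "\<lambda>(f, a). (\<lambda>t\<in>carrier T'. f (?i t), h a)"
  let ?G = "\<lambda>(f, a). (\<lambda>t\<in>carrier T. f (h t), ?i a)"
  have F: "?F x \<in> carrier (wreath S T')" if "x \<in> carrier (wreath S T)" for x
    using that by (auto simp: carrier_wreath i hm dest: PiE_mem)
  have G: "?G x \<in> carrier (wreath S T)" if "x \<in> carrier (wreath S T')" for x
    using that by (auto simp: carrier_wreath i hm dest: PiE_mem)
  have GF: "?G (?F x) = x" if x0: "x \<in> carrier (wreath S T)" for x
  proof -
    obtain f a where x: "x = (f, a)" "f \<in> carrier T \<rightarrow>\<^sub>E carrier S" "a \<in> carrier T"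
      using x0 by (auto simp: carrier_wreath)
    then show ?thesis
      using PiE_arb[OF x(2)] by (auto simp: hm ih restrict_def)
  qed
  have FG: "?F (?G x) = x" if x0: "x \<in> carrier (wreath S T')" for x
  proof -
    obtain f a where x: "x = (f, a)" "f \<in> carrier T' \<rightarrow>\<^sub>E carrier S" "a \<in> carrier T'"
      using x0 by (auto simp: carrier_wreath)
    then show ?thesis
      using PiE_arb[OF x(2)] by (auto simp: i hi restrict_def)
  qed
  have "?F (x \<otimes>\<^bsub>wreath S T\<^esub> y) = ?F x \<otimes>\<^bsub>wreath S T'\<^esub> ?F y"
    if "x \<in> carrier (wreath S T)" "y \<in> carrier (wreath S T)" for x y
    using that
    by (cases x, cases y)
      (simp add: carrier_wreath mult_wreath i hm imult hmult clT' cong: restrict_cong)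
  with F have "?F \<in> hom (wreath S T) (wreath S T')"
    unfolding hom_def by blast
  moreover have "bij_betw ?F (carrier (wreath S T)) (carrier (wreath S T'))"
    by (rule bij_betw_byWitness[where f' = ?G]) (use F G FG GF in blast)+
  ultimately show ?thesis
    by (auto simp: is_iso_def iso_def)
qed

lemma monoid_copy_exists:
  fixes g :: "'a \<Rightarrow> 'b" and V :: "'a monoid"
  assumes g: "inj g" and V: "monoid V"
  shows "\<exists>W :: 'b monoid. monoid W \<and> W \<cong> V"
proof -
  interpret V: monoid V by fact
  let ?i = "inv_into UNIV g"
  define W where "W = \<lparr>carrier = g ` carrier V,
    monoid.mult = (\<lambda>x y. g (?i x \<otimes>\<^bsub>V\<^esub> ?i y)), one = g \<one>\<^bsub>V\<^esub>\<rparr>"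
  have "monoid W"
    by (rule monoidI) (auto simp: W_def inv_f_f[OF g] V.m_assoc)
  moreover have "?i \<in> iso W V"
    by (auto simp: W_def iso_def hom_def bij_betw_def inj_on_def inv_f_f[OF g] image_image)
  ultimately show ?thesis
    by (auto simp: is_iso_def)
qed

lemma iterated_wreath_monoid: "iterated_wreath Ss B W \<Longrightarrow> monoid W"
  by (cases Ss) auto

lemma iterated_wreath_copy:
  fixes g :: "'v \<Rightarrow> 'w" and V :: "'v monoid"
  assumes g: "inj g" and "iterated_wreath Ss B V"
  shows "\<exists>W :: 'w monoid. iterated_wreath Ss B W \<and> W \<cong> V"
  using assms(2)
proof (induction Ss arbitrary: V)
  case Nil
  then obtain W :: "'w monoid" where "monoid W" "W \<cong> V"
    using monoid_copy_exists[OF g] by (metis iterated_wreath.simps(1))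
  with Nil show ?case
    by (auto intro: iso_trans)
next
  case (Cons S Ss)
  then obtain V0 :: "'v monoid" where V0: "iterated_wreath Ss B V0" "V \<cong> wreath S V0"
    by auto
  obtain W0 :: "'w monoid" where W0: "iterated_wreath Ss B W0" "W0 \<cong> V0"
    using Cons.IH[OF V0(1)] by blast
  obtain W :: "'w monoid" where W: "monoid W" "W \<cong> V"
    using monoid_copy_exists[OF g iterated_wreath_monoid[OF Cons.prems]] by blast
  have "V0 \<cong> W0"
    using W0 iterated_wreath_monoid is_iso_sym by blast
  then have "wreath S V0 \<cong> wreath S W0"
    using V0(1) iterated_wreath_monoid wreath_cong by blast
  with W V0 have "W \<cong> wreath S W0"
    by (blast intro: iso_trans)
  with W W0 show ?case
    by auto
qed

theorem iterated_wreath_base: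
  "monoid B \<Longrightarrow> iterated_wreath [] B B"
  by (simp add: is_iso_refl)

theorem iterated_wreath_step:
  fixes S :: "'a monoid" and V :: "'w monoid"
  assumes "monoid S" and V: "iterated_wreath Ss B V"
  shows "\<exists>W :: (('w \<Rightarrow> 'a) \<times> 'w) monoid. iterated_wreath (S # Ss) B W"
proof -
  have inj: "inj (\<lambda>x :: 'w. (\<lambda>_ :: 'w. undefined :: 'a, x))"
    by (auto simp: inj_on_def)
  obtain V' :: "(('w \<Rightarrow> 'a) \<times> 'w) monoid" where V': "iterated_wreath Ss B V'" "V' \<cong> V"
    using iterated_wreath_copy[OF inj V] by blast
  have "V \<cong> V'"
    using V' iterated_wreath_monoid is_iso_sym by blast
  then have "wreath S V \<cong> wreath S V'"
    using V iterated_wreath_monoid wreath_cong by blast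
  then have "iterated_wreath (S # Ss) B (wreath S V)"
    using V'(1) monoid_wreath[OF assms(1) iterated_wreath_monoid[OF V]] by auto
  then show ?thesis by blast
qed

theorem iterated_wreath_unique:
  fixes V :: "'v monoid" and W :: "'w monoid"
  assumes "iterated_wreath Ss B V" and "iterated_wreath Ss B W"
  shows "V \<cong> W"
  using assms
proof (induction Ss arbitrary: V W)
  case Nil
  then show ?case
    by (auto intro: iso_trans is_iso_sym)
next
  case (Cons S Ss)
  obtain V0 :: "'v monoid" where V0: "iterated_wreath Ss B V0" "V \<cong> wreath S V0"
    using Cons.prems(1) by auto
  obtain W0 :: "'w monoid" where W0: "iterated_wreath Ss B W0" "W \<cong> wreath S W0"
    using Cons.prems(2) by auto
  have "wreath S V0 \<cong> wreath S W0"
    using wreath_cong[OF Cons.IH[OF V0(1) W0(1)]] iterated_wreath_monoid[OF V0(1)] .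
  moreover have "wreath S W0 \<cong> W"
    using W0(2) iterated_wreath_monoid[OF Cons.prems(2)] is_iso_sym by blast
  ultimately show ?case
    using V0(2) by (blast intro: iso_trans)
qed

subsection \<open>The factors are monoids\<close>

lemma monoid_map_monoid:
  assumes "F \<subseteq> X \<rightarrow>\<^sub>E X" and "(\<lambda>x\<in>X. x) \<in> F"
    and "\<And>f g. f \<in> F \<Longrightarrow> g \<in> F \<Longrightarrow> compose X g f \<in> F"
  shows "monoid (map_monoid X F)"
proof (rule monoidI)
  fix f g h
  assume "f \<in> carrier (map_monoid X F)" "g \<in> carrier (map_monoid X F)"
    "h \<in> carrier (map_monoid X F)"
  then have "f \<in> X \<rightarrow> X"
    using assms(1) by (auto simp: map_monoid_def)
  then show "f \<otimes>\<^bsub>map_monoid X F\<^esub> g \<otimes>\<^bsub>map_monoid X F\<^esub> h =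
      f \<otimes>\<^bsub>map_monoid X F\<^esub> (g \<otimes>\<^bsub>map_monoid X F\<^esub> h)"
    by (simp add: map_monoid_def compose_assoc)
next
  fix f assume "f \<in> carrier (map_monoid X F)"
  then have f: "f \<in> X \<rightarrow> X" "f \<in> extensional X"
    using assms(1) by (auto simp: map_monoid_def PiE_def)
  then show "\<one>\<^bsub>map_monoid X F\<^esub> \<otimes>\<^bsub>map_monoid X F\<^esub> f = f"
    "f \<otimes>\<^bsub>map_monoid X F\<^esub> \<one>\<^bsub>map_monoid X F\<^esub> = f"
    by (simp_all add: map_monoid_def compose_Id Id_compose)
qed (use assms in \<open>auto simp: map_monoid_def\<close>)

lemma monoid_tilde: "monoid (tilde X)"
  unfolding tilde_def
proof (rule monoid_map_monoid)
  fix f g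
  assume f: "f \<in> insert (\<lambda>x\<in>X. x) ((\<lambda>c. \<lambda>x\<in>X. c) ` X)"
    and g: "g \<in> insert (\<lambda>x\<in>X. x) ((\<lambda>c. \<lambda>x\<in>X. c) ` X)"
  have "compose X (\<lambda>x\<in>X. x) (\<lambda>x\<in>X. x) = (\<lambda>x\<in>X. x)"
    by (auto simp: compose_def restrict_def)
  moreover have "compose X g (\<lambda>x\<in>X. c) = (\<lambda>x\<in>X. g c)" if "c \<in> X" for c
    by (auto simp: compose_def restrict_def)
  moreover have "compose X (\<lambda>x\<in>X. c) (\<lambda>x\<in>X. x) = (\<lambda>x\<in>X. c)" for c :: 'a
    by (auto simp: compose_def restrict_def)
  moreover have "g c \<in> X" if "c \<in> X" for c
    using g that by auto
  ultimately show "compose X g f \<in> insert (\<lambda>x\<in>X. x) ((\<lambda>c. \<lambda>x\<in>X. c) ` X)"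
    using f g by auto
qed auto

lemma monoid_affine_scaling: "monoid (affine_scaling m)"
  unfolding affine_scaling_def
proof (rule monoid_map_monoid)
  have "(\<lambda>v\<in>carrier_vec m. v :: 'a vec) = (\<lambda>v\<in>carrier_vec m. 1 \<cdot>\<^sub>v v + 0\<^sub>v m)"
    by (rule restrict_ext) simp
  then show "(\<lambda>v\<in>carrier_vec m. v)
      \<in> {\<lambda>v\<in>carrier_vec m. l \<cdot>\<^sub>v v + c | l c :: 'a vec. c \<in> carrier_vec m}"
    using zero_carrier_vec by blast
next
  fix f g
  assume "f \<in> {\<lambda>v\<in>carrier_vec m. l \<cdot>\<^sub>v v + c | l c :: 'a vec. c \<in> carrier_vec m}"
    and "g \<in> {\<lambda>v\<in>carrier_vec m. l \<cdot>\<^sub>v v + c | l c :: 'a vec. c \<in> carrier_vec m}"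
  then obtain l c l' c' where
    f: "f = (\<lambda>v\<in>carrier_vec m. l \<cdot>\<^sub>v v + c)" "c \<in> carrier_vec m" and
    g: "g = (\<lambda>v\<in>carrier_vec m. l' \<cdot>\<^sub>v v + c')" "c' \<in> carrier_vec m"
    by blast
  have "compose (carrier_vec m) g f = (\<lambda>v\<in>carrier_vec m. (l' * l) \<cdot>\<^sub>v v + (l' \<cdot>\<^sub>v c + c'))"
    unfolding compose_def
  proof (rule restrict_ext)
    fix v :: "'a vec" assume v: "v \<in> carrier_vec m"
    then show "g (f v) = (l' * l) \<cdot>\<^sub>v v + (l' \<cdot>\<^sub>v c + c')"
      using f(2) g(2) unfolding f(1) g(1) by (auto simp: algebra_simps)
  qed
  moreover have "l' \<cdot>\<^sub>v c + c' \<in> carrier_vec m"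
    using f(2) g(2) by simp
  ultimately show "compose (carrier_vec m) g f
      \<in> {\<lambda>v\<in>carrier_vec m. l \<cdot>\<^sub>v v + c | l c :: 'a vec. c \<in> carrier_vec m}"
    by blast
qed auto

lemma monoid_upper_triangular_monoid: "monoid (upper_triangular_monoid n)"
proof (rule monoidI)
  fix A B :: "'a mat"
  assume "A \<in> carrier (upper_triangular_monoid n)" "B \<in> carrier (upper_triangular_monoid n)"
  then have A: "A \<in> carrier_mat n n" "upper_triangular A"
    and B: "B \<in> carrier_mat n n" "upper_triangular B"
    by (auto simp: upper_triangular_monoid_def)
  have "upper_triangular (A * B)"
  proof (rule upper_triangularI)
    fix i j assume ij: "j < i" "i < dim_row (A * B)"
    have "A $$ (i, l) * B $$ (l, j) = 0" if "l < n" for l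
      using that ij A B upper_triangularD[OF A(2), of l i] upper_triangularD[OF B(2), of j l]
      by (cases "l < i") auto
    then show "(A * B) $$ (i, j) = 0"
      using ij A B by (auto simp: scalar_prod_def intro!: sum.neutral)
  qed
  then show "A \<otimes>\<^bsub>upper_triangular_monoid n\<^esub> B \<in> carrier (upper_triangular_monoid n)"
    using A B by (auto simp: upper_triangular_monoid_def)
qed (auto simp: upper_triangular_monoid_def)

lemma monoid_U1: "monoid U1"
  by (rule monoidI) (auto simp: U1_def)

lemma monoid_direct_power: "monoid M \<Longrightarrow> monoid (direct_power M n)"
proof -
  assume "monoid M"
  then interpret M: monoid M .
  show ?thesis
  proof (rule monoidI)
    fix x assume "x \<in> carrier (direct_power M n)"
    then have x: "x \<in> {..<n} \<rightarrow>\<^sub>E carrier M"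
      by (simp add: direct_power_def)
    have "(\<lambda>i\<in>{..<n}. \<one>\<^bsub>M\<^esub> \<otimes>\<^bsub>M\<^esub> x i) = x" "(\<lambda>i\<in>{..<n}. x i \<otimes>\<^bsub>M\<^esub> \<one>\<^bsub>M\<^esub>) = x"
      using PiE_mem[OF x] PiE_arb[OF x] by (auto simp: restrict_def)
    then show "\<one>\<^bsub>direct_power M n\<^esub> \<otimes>\<^bsub>direct_power M n\<^esub> x = x"
      "x \<otimes>\<^bsub>direct_power M n\<^esub> \<one>\<^bsub>direct_power M n\<^esub> = x"
      by (simp_all add: direct_power_def cong: restrict_cong)
  next
    fix x y z
    assume "x \<in> carrier (direct_power M n)" "y \<in> carrier (direct_power M n)"
      "z \<in> carrier (direct_power M n)"
    then have "x i \<in> carrier M" "y i \<in> carrier M" "z i \<in> carrier M" if "i < n" for i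
      using that by (auto simp: direct_power_def)
    then show "x \<otimes>\<^bsub>direct_power M n\<^esub> y \<otimes>\<^bsub>direct_power M n\<^esub> z =
        x \<otimes>\<^bsub>direct_power M n\<^esub> (y \<otimes>\<^bsub>direct_power M n\<^esub> z)"
      by (auto simp: direct_power_def M.m_assoc restrict_def)
  qed (auto simp: direct_power_def)
qed

lemma monoid_units_of: "monoid M \<Longrightarrow> monoid (units_of M)"
  by (simp add: monoid.units_group group.is_monoid)

end

theory Submission
  imports Defs
begin

text \<open>
  An upper triangular matrix of size \<open>m + 1\<close> consists of its leading block \<open>A\<close>, the rest \<open>d\<close> of
  its last column and its corner \<open>b\<close>, and \<open>(A, d, b)(A', d', b') = (A A', A d' + b' d, b b')\<close>. Hence
  it acts on \<open>k\<^sup>m\<close>, over a state \<open>q \<in> T\<^sub>m(k)\<close>, by the affine scaling map \<open>z \<mapsto> b z + q d\<close>, while \<open>q\<close>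
  moves to \<open>q A\<close>. Such a map is invertible or constant. Keeping the invertible ones in a group
  coordinate and conjugating the constants by the group element accumulated so far exhibits
  \<open>T\<^sub>m\<^sub>+\<^sub>1(k)\<close> as a divisor of the wreath product of the tilde monoid of \<open>k\<^sup>m\<close> with
  \<open>AS\<^sub>m\<^sup>*(k) \<wr> V\<close>, for any \<open>V\<close> divided by \<open>T\<^sub>m(k)\<close>. The induction starts at \<open>T\<^sub>2(k)\<close>,
  where a projective coordinate reduces the information needed about \<open>T\<^sub>1(k)\<close> to whether a
  scalar vanishes.
\<close>

section \<open>Divisions presented as relational coverings\<close>

text \<open>\<open>R\<close> is the graph of a homomorphism from a submonoid of \<open>T\<close> onto \<open>S\<close>.\<close>

locale covering =
  fixes R :: "'b \<Rightarrow> 'a \<Rightarrow> bool" and T :: "'b monoid" and S :: "'a monoid"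
  assumes source: "R t s \<Longrightarrow> t \<in> carrier T"
    and target: "R t s \<Longrightarrow> s \<in> carrier S"
    and one: "R \<one>\<^bsub>T\<^esub> \<one>\<^bsub>S\<^esub>"
    and mult: "R t s \<Longrightarrow> R t' s' \<Longrightarrow> R (t \<otimes>\<^bsub>T\<^esub> t') (s \<otimes>\<^bsub>S\<^esub> s')"
    and functional: "R t s \<Longrightarrow> R t s' \<Longrightarrow> s = s'"
    and onto: "s \<in> carrier S \<Longrightarrow> \<exists>t. R t s"

text \<open>The domain of \<open>R\<close> is the subsemigroup; uniqueness of partners makes the
  description operator a map, and compatibility with products makes it a homomorphism.\<close>

lemma covering_divides:
  assumes "covering R T S"
  shows "divides S T"
proof -
  interpret covering R T S by fact
  let ?U = "{t. \<exists>s. R t s}"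
  let ?h = "\<lambda>t. THE s. R t s"
  have h: "?h t = s" if "R t s" for t s
    using that functional by blast
  have "?h \<in> epi (T\<lparr>carrier := ?U\<rparr>) S"
  proof -
    have "?h ` ?U = carrier S"
      using h target onto by (force simp: image_iff)
    then show ?thesis
      using h mult by (auto simp: epi_def hom_def) 
  qed
  then show ?thesis
    unfolding divides_def using source mult by (intro exI[of _ ?U]) blast
qed

text \<open>\<open>iterated_wreath\<close> fixes a monoid only up to isomorphism, so a covering of
  the concrete wreath product has to be pulled back to the copy.\<close>

lemma covering_iso:
  assumes "covering R T S" and iso: "W \<cong> T" and "monoid W" "monoid T"
  shows "\<exists>R'. covering R' W S"
proof -
  interpret covering R T S by fact
  interpret W: monoid W by fact
  interpret T: monoid T by fact
  obtain h where h: "h \<in> hom W T" "bij_betw h (carrier W) (carrier T)"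
    using iso by (auto simp: is_iso_def iso_def)
  have hm: "h w \<in> carrier T" if "w \<in> carrier W" for w
    using h(2) that by (auto simp: bij_betw_def)
  have hmult: "h (x \<otimes>\<^bsub>W\<^esub> y) = h x \<otimes>\<^bsub>T\<^esub> h y" if "x \<in> carrier W" "y \<in> carrier W" for x y
    using h(1) that by (auto simp: hom_def)
  \<comment> \<open>\<open>hom\<close> preserves products only. The unit is recovered from
    surjectivity: a preimage \<open>e\<close> of the unit of \<open>T\<close> satisfies
    \<open>h 1 = h 1 * h e = h (1 * e) = h e\<close>.\<close>
  have "h \<one>\<^bsub>W\<^esub> = \<one>\<^bsub>T\<^esub>"
  proof -
    obtain e where e: "e \<in> carrier W" "h e = \<one>\<^bsub>T\<^esub>"
      using h(2) T.one_closed by (metis bij_betw_imp_surj_on imageE)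
    have "h \<one>\<^bsub>W\<^esub> = h \<one>\<^bsub>W\<^esub> \<otimes>\<^bsub>T\<^esub> h e"
      using e hm[OF W.one_closed] by simp
    also have "\<dots> = h e"
      using e hmult[OF W.one_closed e(1)] by simp
    finally show ?thesis using e by simp
  qed
  then have "covering (\<lambda>w s. w \<in> carrier W \<and> R (h w) s) W S"
    by unfold_locales
      (use target one mult functional onto source hmult h(2) in
        \<open>auto simp: bij_betw_def\<close>, metis imageE)
  then show ?thesis by blast
qed

section \<open>Wreath products with a tilde monoid over a group\<close>

lemma tilde_closed: "f \<in> carrier (tilde X) \<Longrightarrow> x \<in> X \<Longrightarrow> f x \<in> X"
  by (auto simp: tilde_def map_monoid_def)

lemma tilde_mult: "x \<in> X \<Longrightarrow> (f \<otimes>\<^bsub>tilde X\<^esub> g) x = g (f x)"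
  by (simp add: tilde_def map_monoid_def compose_def)

lemma tilde_one: "x \<in> X \<Longrightarrow> \<one>\<^bsub>tilde X\<^esub> x = x"
  by (simp add: tilde_def map_monoid_def)

text \<open>\<open>E q s d f\<close> says that, over the state \<open>q\<close>, the element \<open>s\<close> can be simulated by the map \<open>f\<close> on \<open>X\<close>
  together with the group element \<open>d\<close>. It is a relation because several pairs may represent the
  same \<open>s\<close>. The value \<open>c \<one>\<close> below is the group element accumulated so far: a point \<open>z\<close> stored in
  the top coordinate stands for \<open>act (c \<one>) z\<close>.\<close>

lemma covering_tilde_wreath:
  fixes V :: "'v monoid" and Q :: "'q monoid" and G :: "'g monoid" and S :: "'s monoid"
    and X :: "'x set" and act :: "'g \<Rightarrow> 'x \<Rightarrow> 'x"
    and E :: "'q \<Rightarrow> 's \<Rightarrow> 'g \<Rightarrow> ('x \<Rightarrow> 'x) \<Rightarrow> bool"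
  assumes R: "covering R V Q" and "monoid V" "monoid Q" "monoid G" "monoid S"
    and act_closed: "\<And>d x. d \<in> carrier G \<Longrightarrow> x \<in> X \<Longrightarrow> act d x \<in> X"
    and act_one: "\<And>x. x \<in> X \<Longrightarrow> act \<one>\<^bsub>G\<^esub> x = x"
    and act_mult: "\<And>c d x. c \<in> carrier G \<Longrightarrow> d \<in> carrier G \<Longrightarrow> x \<in> X \<Longrightarrow>
      act (c \<otimes>\<^bsub>G\<^esub> d) x = act d (act c x)"
    and act_surj: "\<And>d x. d \<in> carrier G \<Longrightarrow> x \<in> X \<Longrightarrow> \<exists>y\<in>X. act d y = x"
    and p_hom: "p \<in> hom S Q" and p_one: "p \<one>\<^bsub>S\<^esub> = \<one>\<^bsub>Q\<^esub>"
    and E_one: "\<And>q. q \<in> carrier Q \<Longrightarrow> E q \<one>\<^bsub>S\<^esub> \<one>\<^bsub>G\<^esub> (\<lambda>x. x)"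
    and E_mult: "\<And>q s s' d d' f f'. \<lbrakk>q \<in> carrier Q; s \<in> carrier S; s' \<in> carrier S;
      d \<in> carrier G; d' \<in> carrier G; f \<in> X \<rightarrow> X; f' \<in> X \<rightarrow> X;
      E q s d f; E (q \<otimes>\<^bsub>Q\<^esub> p s) s' d' f'\<rbrakk> \<Longrightarrow>
      E q (s \<otimes>\<^bsub>S\<^esub> s') (d \<otimes>\<^bsub>G\<^esub> d') (\<lambda>x. f' (f x))"
    and E_ex: "\<And>q s. q \<in> carrier Q \<Longrightarrow> s \<in> carrier S \<Longrightarrow>
      \<exists>d\<in>carrier G. \<exists>f\<in>X \<rightarrow> X. E q s d f \<and>
        ((\<forall>x\<in>X. f x = act d x) \<or> (\<exists>c\<in>X. \<forall>x\<in>X. f x = c))"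
    and E_inj: "\<And>s s' d f f'. \<lbrakk>s \<in> carrier S; s' \<in> carrier S; p s = p s';
      E \<one>\<^bsub>Q\<^esub> s d f; E \<one>\<^bsub>Q\<^esub> s' d f'; \<And>x. x \<in> X \<Longrightarrow> f x = f' x\<rbrakk> \<Longrightarrow> s = s'"
  shows "\<exists>R'. covering R' (wreath (tilde X) (wreath G V)) S"
proof -
  interpret covering R V Q by fact
  interpret V: monoid V by fact
  interpret Q: monoid Q by fact
  interpret G: monoid G by fact
  interpret S: monoid S by fact
  interpret M: monoid "wreath (tilde X) (wreath G V)"
    by (intro monoid_wreath monoid_tilde) fact+
  let ?M = "wreath (tilde X) (wreath G V)"
  let ?\<Gamma> = "carrier V \<rightarrow>\<^sub>E carrier G"
  \<comment> \<open>\<open>F (c, t)\<close> moves stored points while the accumulated element grows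
    from \<open>c \<one>\<close> to \<open>c \<one> \<otimes> g t\<close>; the equation says that
    the represented point moves by \<open>f\<close>. Conditions are imposed only at states
    \<open>t\<close> that have a partner under \<open>R\<close>.\<close>
  define A where "A F g s \<longleftrightarrow> (\<forall>t q. R t q \<longrightarrow> (\<exists>f\<in>X \<rightarrow> X. E q s (g t) f \<and>
      (\<forall>c\<in>?\<Gamma>. \<forall>z\<in>X. act (g t) (act (c \<one>\<^bsub>V\<^esub>) (F (c, t) z)) = f (act (c \<one>\<^bsub>V\<^esub>) z))))"
    for F :: "('v \<Rightarrow> 'g) \<times> 'v \<Rightarrow> 'x \<Rightarrow> 'x" and g s
  define R' where "R' w s \<longleftrightarrow> w \<in> carrier ?M \<and> s \<in> carrier S \<and>
      R (snd (snd w)) (p s) \<and> A (fst w) (fst (snd w)) s" for w s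
  have ev: "c \<one>\<^bsub>V\<^esub> \<in> carrier G" if "c \<in> ?\<Gamma>" for c
    using that by auto
  have "covering R' ?M S"
  proof
    fix t s assume "R' t s"
    then show "t \<in> carrier ?M" "s \<in> carrier S"
      by (auto simp: R'_def)
  next
    have "A (\<lambda>t\<in>carrier (wreath G V). \<one>\<^bsub>tilde X\<^esub>) (\<lambda>t\<in>carrier V. \<one>\<^bsub>G\<^esub>) \<one>\<^bsub>S\<^esub>"
      unfolding A_def
    proof (intro allI impI)
      fix t q assume "R t q"
      then have "t \<in> carrier V" "q \<in> carrier Q"
        using source target by auto
      then show "\<exists>f\<in>X \<rightarrow> X. E q \<one>\<^bsub>S\<^esub> ((\<lambda>t\<in>carrier V. \<one>\<^bsub>G\<^esub>) t) f \<and> (\<forall>c\<in>?\<Gamma>. \<forall>z\<in>X.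
          act ((\<lambda>t\<in>carrier V. \<one>\<^bsub>G\<^esub>) t) (act (c \<one>\<^bsub>V\<^esub>)
            ((\<lambda>t\<in>carrier (wreath G V). \<one>\<^bsub>tilde X\<^esub>) (c, t) z)) = f (act (c \<one>\<^bsub>V\<^esub>) z))"
        by (intro bexI[of _ "\<lambda>x. x"])
          (auto simp: E_one carrier_wreath tilde_one act_one act_closed ev)
    qed
    then show "R' \<one>\<^bsub>?M\<^esub> \<one>\<^bsub>S\<^esub>"
      using one M.one_closed by (simp add: R'_def one_wreath p_one)
  next
    fix w1 s1 w2 s2 assume as: "R' w1 s1" "R' w2 s2"
    obtain F1 g1 v1 F2 g2 v2 where w: "w1 = (F1, (g1, v1))" "w2 = (F2, (g2, v2))"
      by (metis prod.collapse)
    have s: "s1 \<in> carrier S" "s2 \<in> carrier S"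
      and Rv: "R v1 (p s1)" "R v2 (p s2)" and A1: "A F1 g1 s1" and A2: "A F2 g2 s2"
      and F: "F1 \<in> carrier (wreath G V) \<rightarrow>\<^sub>E carrier (tilde X)"
         "F2 \<in> carrier (wreath G V) \<rightarrow>\<^sub>E carrier (tilde X)"
      and g: "g1 \<in> ?\<Gamma>" "g2 \<in> ?\<Gamma>" and v: "v1 \<in> carrier V" "v2 \<in> carrier V"
      using as by (auto simp: R'_def w carrier_wreath)
    obtain F g where fg: "w1 \<otimes>\<^bsub>?M\<^esub> w2 = (F, (g, v1 \<otimes>\<^bsub>V\<^esub> v2))"
      "F = (\<lambda>t\<in>carrier (wreath G V). F1 t \<otimes>\<^bsub>tilde X\<^esub> F2 (t \<otimes>\<^bsub>wreath G V\<^esub> (g1, v1)))"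
      "g = (\<lambda>t\<in>carrier V. g1 t \<otimes>\<^bsub>G\<^esub> g2 (t \<otimes>\<^bsub>V\<^esub> v1))"
      by (simp add: w mult_wreath)
    have "A F g (s1 \<otimes>\<^bsub>S\<^esub> s2)"
      unfolding A_def
    proof (intro allI impI)
      fix t q assume tq: "R t q"
      have t: "t \<in> carrier V" "q \<in> carrier Q"
        using tq source target by auto
      have gt: "g1 t \<in> carrier G" "g2 (t \<otimes>\<^bsub>V\<^esub> v1) \<in> carrier G"
        using g t v by auto
      obtain f1 where f1: "f1 \<in> X \<rightarrow> X" "E q s1 (g1 t) f1"
        "\<And>c z. c \<in> ?\<Gamma> \<Longrightarrow> z \<in> X \<Longrightarrow>
          act (g1 t) (act (c \<one>\<^bsub>V\<^esub>) (F1 (c, t) z)) = f1 (act (c \<one>\<^bsub>V\<^esub>) z)"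
        using A1 tq unfolding A_def by blast
      obtain f2 where f2: "f2 \<in> X \<rightarrow> X" "E (q \<otimes>\<^bsub>Q\<^esub> p s1) s2 (g2 (t \<otimes>\<^bsub>V\<^esub> v1)) f2"
        "\<And>c z. c \<in> ?\<Gamma> \<Longrightarrow> z \<in> X \<Longrightarrow>
          act (g2 (t \<otimes>\<^bsub>V\<^esub> v1)) (act (c \<one>\<^bsub>V\<^esub>) (F2 (c, t \<otimes>\<^bsub>V\<^esub> v1) z)) = f2 (act (c \<one>\<^bsub>V\<^esub>) z)"
        using A2 mult[OF tq Rv(1)] unfolding A_def by blast
      show "\<exists>f\<in>X \<rightarrow> X. E q (s1 \<otimes>\<^bsub>S\<^esub> s2) (g t) f \<and> (\<forall>c\<in>?\<Gamma>. \<forall>z\<in>X.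
          act (g t) (act (c \<one>\<^bsub>V\<^esub>) (F (c, t) z)) = f (act (c \<one>\<^bsub>V\<^esub>) z))"
      proof (intro bexI[of _ "\<lambda>x. f2 (f1 x)"] conjI ballI)
        show "E q (s1 \<otimes>\<^bsub>S\<^esub> s2) (g t) (\<lambda>x. f2 (f1 x))"
          using E_mult[OF t(2) s gt f1(1) f2(1) f1(2) f2(2)] t by (simp add: fg)
      next
        fix c z assume c: "c \<in> ?\<Gamma>" and z: "z \<in> X"
        \<comment> \<open>The first coordinate of \<open>(c, t)\<close> times
          \<open>(g1, v1)\<close> in \<open>wreath G V\<close>. Its value at the unit is the element
          accumulated after the first factor has acted.\<close>
        define c' where "c' = (\<lambda>r\<in>carrier V. c r \<otimes>\<^bsub>G\<^esub> g1 (r \<otimes>\<^bsub>V\<^esub> t))"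
        have c': "c' \<in> ?\<Gamma>"
          using c g t by (auto simp: c'_def)
        have c'1: "c' \<one>\<^bsub>V\<^esub> = c \<one>\<^bsub>V\<^esub> \<otimes>\<^bsub>G\<^esub> g1 t"
          using t by (simp add: c'_def)
        have ct: "(c, t) \<in> carrier (wreath G V)"
          using c t by (simp add: carrier_wreath)
        have Fz: "F (c, t) z = F2 (c', t \<otimes>\<^bsub>V\<^esub> v1) (F1 (c, t) z)"
          using z ct by (simp add: fg tilde_mult mult_wreath c'_def)
        have z1: "F1 (c, t) z \<in> X"
          using F(1) ct z tilde_closed by (metis PiE_mem)
        have ct': "(c', t \<otimes>\<^bsub>V\<^esub> v1) \<in> carrier (wreath G V)"
          using c' t v by (simp add: carrier_wreath)
        have z2: "F (c, t) z \<in> X"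
          unfolding Fz using F(2) ct' z1 tilde_closed by (metis PiE_mem)
        have "act (g t) (act (c \<one>\<^bsub>V\<^esub>) (F (c, t) z)) =
            act (g2 (t \<otimes>\<^bsub>V\<^esub> v1)) (act (c' \<one>\<^bsub>V\<^esub>) (F (c, t) z))"
          using t gt ev[OF c] z2 by (simp add: fg(3) c'1 act_mult act_closed)
        also have "\<dots> = f2 (act (c' \<one>\<^bsub>V\<^esub>) (F1 (c, t) z))"
          using f2(3)[OF c' z1] by (simp add: Fz)
        also have "\<dots> = f2 (f1 (act (c \<one>\<^bsub>V\<^esub>) z))"
          using f1(3)[OF c z] z1 gt ev[OF c] by (simp add: c'1 act_mult)
        finally show "act (g t) (act (c \<one>\<^bsub>V\<^esub>) (F (c, t) z)) = f2 (f1 (act (c \<one>\<^bsub>V\<^esub>) z))" .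
      qed (use f1 f2 in auto)
    qed
    moreover have "p (s1 \<otimes>\<^bsub>S\<^esub> s2) = p s1 \<otimes>\<^bsub>Q\<^esub> p s2"
      using p_hom s by (auto simp: hom_def)
    moreover have "w1 \<otimes>\<^bsub>?M\<^esub> w2 \<in> carrier ?M"
      using as M.m_closed by (simp add: R'_def)
    ultimately show "R' (w1 \<otimes>\<^bsub>?M\<^esub> w2) (s1 \<otimes>\<^bsub>S\<^esub> s2)"
      using mult[OF Rv] s by (simp add: R'_def fg(1))
  next
    fix w s s' assume as: "R' w s" "R' w s'"
    obtain F g v where w: "w = (F, (g, v))"
      by (metis prod.collapse)
    have s: "s \<in> carrier S" "s' \<in> carrier S" and A: "A F g s" "A F g s'"
      and F: "F \<in> carrier (wreath G V) \<rightarrow>\<^sub>E carrier (tilde X)"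
      and p: "p s = p s'"
      using as functional by (auto simp: R'_def w carrier_wreath)
    \<comment> \<open>At the unit state with trivial accumulation, the same value computed from
      \<open>F\<close> and \<open>g\<close> equals both \<open>f z\<close> and \<open>f' z\<close>,
      so the two maps agree on \<open>X\<close>.\<close>
    define c where "c = (\<lambda>r\<in>carrier V. \<one>\<^bsub>G\<^esub>)"
    have c: "c \<in> ?\<Gamma>" "c \<one>\<^bsub>V\<^esub> = \<one>\<^bsub>G\<^esub>"
      by (auto simp: c_def)
    obtain f where f: "E \<one>\<^bsub>Q\<^esub> s (g \<one>\<^bsub>V\<^esub>) f"
      "\<And>z. z \<in> X \<Longrightarrow> act (g \<one>\<^bsub>V\<^esub>) (act \<one>\<^bsub>G\<^esub> (F (c, \<one>\<^bsub>V\<^esub>) z)) = f (act \<one>\<^bsub>G\<^esub> z)"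
      using A(1) one c unfolding A_def by metis
    obtain f' where f': "E \<one>\<^bsub>Q\<^esub> s' (g \<one>\<^bsub>V\<^esub>) f'"
      "\<And>z. z \<in> X \<Longrightarrow> act (g \<one>\<^bsub>V\<^esub>) (act \<one>\<^bsub>G\<^esub> (F (c, \<one>\<^bsub>V\<^esub>) z)) = f' (act \<one>\<^bsub>G\<^esub> z)"
      using A(2) one c unfolding A_def by metis
    show "s = s'"
      by (rule E_inj[OF s p f(1) f'(1)]) (metis f(2) f'(2) act_one)
  next
    fix s assume s: "s \<in> carrier S"
    have ps: "p s \<in> carrier Q"
      using p_hom s by (auto simp: hom_def)
    then obtain v where v: "R v (p s)"
      using onto by blast
    \<comment> \<open>The choice of \<open>d\<close> and \<open>f\<close> can depend on
      \<open>t\<close> alone: \<open>R\<close> is functional, so \<open>t\<close> has at most one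
      partner \<open>q\<close>. Without a partner any group element serves.\<close>
    have "\<exists>d f. d \<in> carrier G \<and> (\<forall>q. R t q \<longrightarrow> f \<in> X \<rightarrow> X \<and> E q s d f \<and>
        ((\<forall>x\<in>X. f x = act d x) \<or> (\<exists>c\<in>X. \<forall>x\<in>X. f x = c)))" for t
    proof (cases "\<exists>q. R t q")
      case True
      then obtain q where q: "R t q" by blast
      then have "q' = q" if "R t q'" for q'
        using functional that by blast
      then show ?thesis
        using E_ex[OF target[OF q] s] by metis
    qed (use G.one_closed in blast)
    then obtain D P where D: "\<And>t. D t \<in> carrier G"
      and P: "\<And>t q. R t q \<Longrightarrow> P t \<in> X \<rightarrow> X" "\<And>t q. R t q \<Longrightarrow> E q s (D t) (P t)"
      "\<And>t q. R t q \<Longrightarrow> (\<forall>x\<in>X. P t x = act (D t) x) \<or> (\<exists>c\<in>X. \<forall>x\<in>X. P t x = c)"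
      by metis
    \<comment> \<open>The equation is solved for \<open>h\<close> inside the tilde monoid. If
      \<open>P t\<close> is the action of \<open>D t\<close>, the identity solves it; if
      \<open>P t\<close> is constant, its value is pulled back through both actions, which are
      surjective, and \<open>h\<close> is the constant map at the resulting point.\<close>
    have "\<exists>h\<in>carrier (tilde X). \<forall>q. R t q \<longrightarrow>
        (\<forall>z\<in>X. act (D t) (act (c \<one>\<^bsub>V\<^esub>) (h z)) = P t (act (c \<one>\<^bsub>V\<^esub>) z))"
      if c: "c \<in> ?\<Gamma>" for c t
    proof (cases "\<exists>q. R t q \<and> \<not> (\<forall>x\<in>X. P t x = act (D t) x)")
      case True
      then obtain q where q: "R t q" "\<not> (\<forall>x\<in>X. P t x = act (D t) x)" by blast
      then obtain a where a: "a \<in> X" "\<And>x. x \<in> X \<Longrightarrow> P t x = a"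
        using P(3) by blast
      obtain b where b: "b \<in> X" "act (D t) b = a"
        using act_surj[OF D a(1)] by blast
      obtain y where y: "y \<in> X" "act (c \<one>\<^bsub>V\<^esub>) y = b"
        using act_surj[OF ev[OF c] b(1)] by blast
      have "(\<lambda>x\<in>X. y) \<in> carrier (tilde X)"
        using y(1) by (auto simp: tilde_def map_monoid_def)
      then show ?thesis
        using a b y act_closed[OF ev[OF c]] by (intro bexI[of _ "\<lambda>x\<in>X. y"]) auto
    next
      case False
      then show ?thesis
        using act_closed[OF ev[OF c]] monoid.one_closed[OF monoid_tilde]
        by (intro bexI[of _ "\<one>\<^bsub>tilde X\<^esub>"]) (auto simp: tilde_one)
    qed
    then obtain H where H: "\<And>c t. c \<in> ?\<Gamma> \<Longrightarrow> H c t \<in> carrier (tilde X)"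
      "\<And>c t q z. c \<in> ?\<Gamma> \<Longrightarrow> R t q \<Longrightarrow> z \<in> X \<Longrightarrow>
        act (D t) (act (c \<one>\<^bsub>V\<^esub>) (H c t z)) = P t (act (c \<one>\<^bsub>V\<^esub>) z)"
      by metis
    define F where "F = (\<lambda>(c, t)\<in>carrier (wreath G V). H c t)"
    define g where "g = (\<lambda>t\<in>carrier V. D t)"
    have "A F g s"
      unfolding A_def
    proof (intro allI impI)
      fix t q assume tq: "R t q"
      then have "t \<in> carrier V"
        using source by blast
      then show "\<exists>f\<in>X \<rightarrow> X. E q s (g t) f \<and> (\<forall>c\<in>?\<Gamma>. \<forall>z\<in>X.
          act (g t) (act (c \<one>\<^bsub>V\<^esub>) (F (c, t) z)) = f (act (c \<one>\<^bsub>V\<^esub>) z))"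
        using P(1,2)[OF tq] H(2)[OF _ tq]
        by (intro bexI[of _ "P t"]) (auto simp: g_def F_def carrier_wreath)
    qed
    moreover have "(F, (g, v)) \<in> carrier ?M"
      using H(1) D source[OF v] by (auto simp: carrier_wreath F_def g_def)
    ultimately have "R' (F, (g, v)) s"
      using s v by (simp add: R'_def)
    then show "\<exists>w. R' w s" by blast
  qed
  then show ?thesis by blast
qed

section \<open>Units among the affine scaling maps\<close>

lemma affine_mult: "x \<in> carrier_vec m \<Longrightarrow> (f \<otimes>\<^bsub>units_of (affine_scaling m)\<^esub> g) x = g (f x)"
  by (simp add: units_of_def affine_scaling_def map_monoid_def compose_def)

lemma affine_one: "x \<in> carrier_vec m \<Longrightarrow> \<one>\<^bsub>units_of (affine_scaling m)\<^esub> x = x"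
  by (simp add: units_of_def affine_scaling_def map_monoid_def)

lemma affine_scaling_closed:
  "f \<in> carrier (affine_scaling m) \<Longrightarrow> x \<in> carrier_vec m \<Longrightarrow> f x \<in> carrier_vec m"
  by (auto simp: affine_scaling_def map_monoid_def)

lemma affine_unit_closed:
  "f \<in> carrier (units_of (affine_scaling m)) \<Longrightarrow> x \<in> carrier_vec m \<Longrightarrow> f x \<in> carrier_vec m"
  by (rule affine_scaling_closed) (simp_all add: units_of_def Units_def)

lemma affine_unit_surj:
  assumes "f \<in> carrier (units_of (affine_scaling m))" "x \<in> carrier_vec m"
  shows "\<exists>y\<in>carrier_vec m. f y = x"
proof -
  obtain g where g: "g \<in> carrier (affine_scaling m)"
    "g \<otimes>\<^bsub>affine_scaling m\<^esub> f = \<one>\<^bsub>affine_scaling m\<^esub>"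
    using assms(1) by (auto simp: units_of_def Units_def)
  then have "compose (carrier_vec m) f g x = x"
    using assms(2) by (simp add: affine_scaling_def map_monoid_def)
  then show ?thesis
    using affine_scaling_closed[OF g(1) assms(2)] assms(2)
    by (auto simp: compose_def)
qed

text \<open>Solving \<open>w = l v + c\<close> for \<open>v\<close> gives the inverse, an affine
  scaling map with scalar \<open>1 / l\<close> and translation \<open>- c / l\<close>.\<close>

lemma affine_unit:
  fixes l :: "'k::field"
  assumes "l \<noteq> 0" "c \<in> carrier_vec m"
  shows "(\<lambda>v\<in>carrier_vec m. l \<cdot>\<^sub>v v + c) \<in> carrier (units_of (affine_scaling m))"
proof -
  let ?X = "carrier_vec m :: 'k vec set"
  let ?f = "\<lambda>v\<in>?X. l \<cdot>\<^sub>v v + c"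
  let ?g = "\<lambda>v\<in>?X. (1 / l) \<cdot>\<^sub>v v + (- 1 / l) \<cdot>\<^sub>v c"
  have "compose ?X ?g ?f = (\<lambda>v\<in>?X. v)"
    unfolding compose_def
  proof (rule restrict_ext)
    fix v assume "v \<in> ?X"
    then show "?g (?f v) = v"
      using assms by (auto intro!: eq_vecI simp: field_simps)
  qed
  moreover have "compose ?X ?f ?g = (\<lambda>v\<in>?X. v)"
    unfolding compose_def
  proof (rule restrict_ext)
    fix v assume "v \<in> ?X"
    then show "?f (?g v) = v"
      using assms by (auto intro!: eq_vecI simp: field_simps)
  qed
  moreover have "?f \<in> carrier (affine_scaling m)"
    using assms(2) by (auto simp: affine_scaling_def map_monoid_def)
  moreover have "?g \<in> carrier (affine_scaling m)"
    unfolding affine_scaling_def map_monoid_def partial_object.simps using assms(2)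
    by (intro CollectI exI[of _ "1 / l"] exI[of _ "(- 1 / l) \<cdot>\<^sub>v c"]) simp
  moreover have "f \<otimes>\<^bsub>affine_scaling m\<^esub> g = compose ?X g f"
    and "\<one>\<^bsub>affine_scaling m\<^esub> = (\<lambda>v\<in>?X. v)" for f g :: "'k vec \<Rightarrow> 'k vec"
    by (simp_all add: affine_scaling_def map_monoid_def)
  ultimately show ?thesis
    unfolding units_of_def Units_def partial_object.simps mem_Collect_eq by metis
qed

section \<open>Block form of upper triangular matrices\<close>

definition leading_block :: "nat \<Rightarrow> 'k mat \<Rightarrow> 'k mat" where
  "leading_block m A = mat m m (\<lambda>ij. A $$ ij)"

definition last_column :: "nat \<Rightarrow> 'k mat \<Rightarrow> 'k vec" where
  "last_column m A = vec m (\<lambda>i. A $$ (i, m))"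

lemma leading_block_carrier [simp]: "leading_block m A \<in> carrier_mat m m"
  by (simp add: leading_block_def)

lemma last_column_carrier [simp]: "last_column m A \<in> carrier_vec m"
  by (simp add: last_column_def)

lemma last_column_dim [simp]: "dim_vec (last_column m A) = m"
  by (simp add: last_column_def)

lemma upper_triangular_carrier:
  "A \<in> carrier (upper_triangular_monoid n) \<longleftrightarrow> A \<in> carrier_mat n n \<and> (\<forall>i<n. \<forall>j<i. A $$ (i, j) = 0)"
  by (auto simp: upper_triangular_monoid_def upper_triangular_def)

lemma upper_triangular_mult [simp]: "A \<otimes>\<^bsub>upper_triangular_monoid n\<^esub> B = A * B"
  by (simp add: upper_triangular_monoid_def)

lemma upper_triangular_one [simp]: "\<one>\<^bsub>upper_triangular_monoid n\<^esub> = 1\<^sub>m n"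
  by (simp add: upper_triangular_monoid_def)

lemma index_mult_Suc:
  assumes "A \<in> carrier_mat (Suc m) (Suc m)" "B \<in> carrier_mat (Suc m) (Suc m)" "i \<le> m" "j \<le> m"
  shows "(A * B) $$ (i, j) = (\<Sum>l<m. A $$ (i, l) * B $$ (l, j)) + A $$ (i, m) * B $$ (m, j)"
  using assms by (auto simp: scalar_prod_def atLeast0LessThan)

text \<open>Once the last summand is split off each entry, the zeros in the bottom row of
  \<open>B\<close> kill it within the leading block, and those of \<open>A\<close> kill the
  remaining sum in the corner. In the last column both parts survive.\<close>

lemma
  fixes A B :: "'k::field mat"
  assumes "A \<in> carrier (upper_triangular_monoid (Suc m))"
    and "B \<in> carrier (upper_triangular_monoid (Suc m))"
  shows leading_block_mult: "leading_block m (A * B) = leading_block m A * leading_block m B"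
    and last_column_mult: "last_column m (A * B) =
      leading_block m A *\<^sub>v last_column m B + B $$ (m, m) \<cdot>\<^sub>v last_column m A"
    and corner_mult: "(A * B) $$ (m, m) = A $$ (m, m) * B $$ (m, m)"
proof -
  have A: "A \<in> carrier_mat (Suc m) (Suc m)" "\<And>i j. i < Suc m \<Longrightarrow> j < i \<Longrightarrow> A $$ (i, j) = 0"
    and B: "B \<in> carrier_mat (Suc m) (Suc m)" "\<And>i j. i < Suc m \<Longrightarrow> j < i \<Longrightarrow> B $$ (i, j) = 0"
    using assms by (auto simp: upper_triangular_carrier)
  note entry = index_mult_Suc[OF A(1) B(1)]
  have "(leading_block m A * leading_block m B) $$ (i, j) = (\<Sum>l<m. A $$ (i, l) * B $$ (l, j))"
    if "i < m" "j < m" for i j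
    using that by (simp add: leading_block_def scalar_prod_def atLeast0LessThan)
  moreover have "leading_block m (A * B) $$ (i, j) = (A * B) $$ (i, j)" if "i < m" "j < m" for i j
    using that by (simp add: leading_block_def)
  ultimately show "leading_block m (A * B) = leading_block m A * leading_block m B"
    by (intro eq_matI)
      (auto simp: leading_block_def entry B(2) simp del: index_mult_mat(1))
  show "last_column m (A * B) =
      leading_block m A *\<^sub>v last_column m B + B $$ (m, m) \<cdot>\<^sub>v last_column m A"
    by (rule eq_vecI)
      (auto simp: leading_block_def last_column_def entry scalar_prod_def atLeast0LessThan
        simp del: index_mult_mat(1))
  show "(A * B) $$ (m, m) = A $$ (m, m) * B $$ (m, m)"
    by (simp add: entry A(2) del: index_mult_mat(1))
qed

lemma leading_block_closed:
  "A \<in> carrier (upper_triangular_monoid (Suc m)) \<Longrightarrow>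
    leading_block m A \<in> carrier (upper_triangular_monoid m)"
  by (auto simp: upper_triangular_carrier leading_block_def)

lemma leading_block_hom:
  "leading_block m \<in> hom (upper_triangular_monoid (Suc m)) (upper_triangular_monoid m)"
  by (auto simp: hom_def leading_block_closed leading_block_mult)

lemma eq_by_blocks:
  assumes "A \<in> carrier (upper_triangular_monoid (Suc m))"
    and "B \<in> carrier (upper_triangular_monoid (Suc m))"
    and "leading_block m A = leading_block m B" "last_column m A = last_column m B"
    and "A $$ (m, m) = B $$ (m, m)"
  shows "A = B"
proof (rule eq_matI)
  fix i j assume ij: "i < dim_row B" "j < dim_col B"
  have A: "A \<in> carrier_mat (Suc m) (Suc m)" "\<And>i j. i < Suc m \<Longrightarrow> j < i \<Longrightarrow> A $$ (i, j) = 0"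
    and B: "B \<in> carrier_mat (Suc m) (Suc m)" "\<And>i j. i < Suc m \<Longrightarrow> j < i \<Longrightarrow> B $$ (i, j) = 0"
    using assms by (auto simp: upper_triangular_carrier)
  have lead: "A $$ (i, j) = B $$ (i, j)" if "i < m" "j < m"
    using arg_cong[OF assms(3), of "\<lambda>C. C $$ (i, j)"] that by (simp add: leading_block_def)
  have last: "A $$ (i, m) = B $$ (i, m)" if "i < m"
    using arg_cong[OF assms(4), of "\<lambda>c. c $ i"] that by (simp add: last_column_def)
  have "i \<le> m" "j \<le> m"
    using ij B(1) by auto
  then consider "i < m" "j < m" | "i < m" "j = m" | "i = m" "j = m" | "i = m" "j < i"
    by linarith
  then show "A $$ (i, j) = B $$ (i, j)"
    by cases (simp_all add: lead last A(2) B(2) assms(5))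
qed (use assms in \<open>auto simp: upper_triangular_carrier\<close>)

section \<open>From size m to size m + 1\<close>

text \<open>The value at zero gives the translation and the value at a unit vector then gives the
  scalar; \<open>m > 0\<close> provides that vector.\<close>

lemma smult_add_eqD:
  fixes b b' :: "'k::field"
  assumes "m > 0" and c: "c \<in> carrier_vec m" "c' \<in> carrier_vec m"
    and eq: "\<And>z. z \<in> carrier_vec m \<Longrightarrow> b \<cdot>\<^sub>v z + c = b' \<cdot>\<^sub>v z + c'"
  shows "b = b' \<and> c = c'"
proof
  show cc: "c = c'"
  proof -
    have "a \<cdot>\<^sub>v 0\<^sub>v m = 0\<^sub>v m" for a :: 'k
      by auto
    then show ?thesis
      using eq[of "0\<^sub>v m"] c by simp
  qed
  have "(b \<cdot>\<^sub>v unit_vec m 0 + c) $ 0 = (b' \<cdot>\<^sub>v unit_vec m 0 + c') $ 0"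
    using eq[of "unit_vec m 0"] by simp
  then show "b = b'"
    using \<open>m > 0\<close> c by (simp add: cc)
qed

lemma zero_smult_add:
  fixes z c :: "'k::field vec"
  assumes "z \<in> carrier_vec m" "c \<in> carrier_vec m"
  shows "0 \<cdot>\<^sub>v z + c = c"
  using assms by (intro eq_vecI) auto

text \<open>Units act by application, and \<open>E\<close> asks \<open>f\<close> to be the affine
  map that the matrix induces over the state \<open>q\<close>. The block product law makes these
  maps compose, and the map over the identity state determines the corner and the last
  column.\<close>

lemma covering_step:
  assumes R: "covering R V (upper_triangular_monoid m :: 'k::field mat monoid)"
    and V: "monoid V" and m: "m > 0"
  shows "\<exists>R'. covering R' (wreath (tilde (carrier_vec m :: 'k vec set))
    (wreath (units_of (affine_scaling m :: ('k vec \<Rightarrow> 'k vec) monoid)) V)) (upper_triangular_monoid (Suc m) :: 'k mat monoid)"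
proof (rule covering_tilde_wreath[OF R V, where act = "\<lambda>f. f" and p = "leading_block m" and
    E = "\<lambda>q A d f. \<forall>z\<in>carrier_vec m. f z = A $$ (m, m) \<cdot>\<^sub>v z + q *\<^sub>v last_column m A"])
  show "leading_block m \<one>\<^bsub>upper_triangular_monoid (Suc m)\<^esub> =
      (\<one>\<^bsub>upper_triangular_monoid m\<^esub> :: 'k mat)"
    by (rule eq_matI) (auto simp: leading_block_def)
next
  fix q :: "'k mat" assume "q \<in> carrier (upper_triangular_monoid m)"
  moreover have "last_column m (1\<^sub>m (Suc m)) = (0\<^sub>v m :: 'k vec)"
    by (rule eq_vecI) (auto simp: last_column_def)
  ultimately show "\<forall>z\<in>carrier_vec m.
      z = \<one>\<^bsub>upper_triangular_monoid (Suc m)\<^esub> $$ (m, m) \<cdot>\<^sub>v z +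
        q *\<^sub>v last_column m \<one>\<^bsub>upper_triangular_monoid (Suc m)\<^esub>"
    by (auto simp: upper_triangular_carrier)
next
  fix q A B :: "'k mat" and d d' :: "'k vec \<Rightarrow> 'k vec" and f f' :: "'k vec \<Rightarrow> 'k vec"
  assume q: "q \<in> carrier (upper_triangular_monoid m)"
    and A: "A \<in> carrier (upper_triangular_monoid (Suc m))"
    and B: "B \<in> carrier (upper_triangular_monoid (Suc m))"
    and f: "f \<in> carrier_vec m \<rightarrow> carrier_vec m"
    and E: "\<forall>z\<in>carrier_vec m. f z = A $$ (m, m) \<cdot>\<^sub>v z + q *\<^sub>v last_column m A"
      "\<forall>z\<in>carrier_vec m. f' z = B $$ (m, m) \<cdot>\<^sub>v z +
        (q \<otimes>\<^bsub>upper_triangular_monoid m\<^esub> leading_block m A) *\<^sub>v last_column m B"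
  have q': "q \<in> carrier_mat m m"
    using q by (simp add: upper_triangular_carrier)
  show "\<forall>z\<in>carrier_vec m. f' (f z) =
      (A \<otimes>\<^bsub>upper_triangular_monoid (Suc m)\<^esub> B) $$ (m, m) \<cdot>\<^sub>v z +
        q *\<^sub>v last_column m (A \<otimes>\<^bsub>upper_triangular_monoid (Suc m)\<^esub> B)"
  proof
    fix z :: "'k vec" assume z: "z \<in> carrier_vec m"
    have "f' (f z) = B $$ (m, m) \<cdot>\<^sub>v (A $$ (m, m) \<cdot>\<^sub>v z + q *\<^sub>v last_column m A) +
        (q * leading_block m A) *\<^sub>v last_column m B"
      using E f z by (simp add: Pi_iff del: smult_add_distrib_vec)
    \<comment> \<open>With blocks \<open>(A, d, b)\<close> and \<open>(A', d', b')\<close> this is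
      \<open>b' (b z + q d) + (q A) d' = b b' z + q (A d' + b' d)\<close>; the last bracket is the
      last column of the product.\<close>
    also have "\<dots> = (A $$ (m, m) * B $$ (m, m)) \<cdot>\<^sub>v z +
        q *\<^sub>v (leading_block m A *\<^sub>v last_column m B + B $$ (m, m) \<cdot>\<^sub>v last_column m A)"
    proof -
      have "q *\<^sub>v (leading_block m A *\<^sub>v last_column m B + B $$ (m, m) \<cdot>\<^sub>v last_column m A) =
          (q * leading_block m A) *\<^sub>v last_column m B + B $$ (m, m) \<cdot>\<^sub>v (q *\<^sub>v last_column m A)"
        using q' mult_mat_vec_carrier[OF leading_block_carrier last_column_carrier, of m A B]
        by (simp add: mult_add_distrib_mat_vec[of _ m m] mult_mat_vec[of _ m m]
            assoc_mult_mat_vec[of _ m m _ m])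
      then show ?thesis
        using q' z by (auto intro!: eq_vecI simp: algebra_simps)
    qed
    finally show "f' (f z) =
      (A \<otimes>\<^bsub>upper_triangular_monoid (Suc m)\<^esub> B) $$ (m, m) \<cdot>\<^sub>v z +
        q *\<^sub>v last_column m (A \<otimes>\<^bsub>upper_triangular_monoid (Suc m)\<^esub> B)"
      by (simp add: last_column_mult[OF A B] corner_mult[OF A B])
  qed
next
  fix q A :: "'k mat"
  assume q: "q \<in> carrier (upper_triangular_monoid m)"
  let ?c = "q *\<^sub>v last_column m A"
  let ?f = "\<lambda>z\<in>carrier_vec m. A $$ (m, m) \<cdot>\<^sub>v z + ?c"
  have c: "?c \<in> carrier_vec m"
    using q by (auto simp: upper_triangular_carrier)
  show "\<exists>d\<in>carrier (units_of (affine_scaling m)). \<exists>f\<in>carrier_vec m \<rightarrow> carrier_vec m.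
      (\<forall>z\<in>carrier_vec m. f z = A $$ (m, m) \<cdot>\<^sub>v z + ?c) \<and>
      ((\<forall>x\<in>carrier_vec m. f x = d x) \<or> (\<exists>c\<in>carrier_vec m. \<forall>x\<in>carrier_vec m. f x = c))"
  \<comment> \<open>A zero corner leaves the constant map with value \<open>?c\<close>, paired with
    the identity of the group; a nonzero corner gives a unit, which serves as both \<open>d\<close>
    and \<open>f\<close>.\<close>
  proof (cases "A $$ (m, m) = 0")
    case True
    have "?c = A $$ (m, m) \<cdot>\<^sub>v z + ?c" if "z \<in> carrier_vec m" for z
      using zero_smult_add[OF that c] True by simp
    then show ?thesis
      using c monoid.one_closed[OF monoid_units_of[OF monoid_affine_scaling]]
      by - (rule bexI[of _ "\<one>\<^bsub>units_of (affine_scaling m)\<^esub>"], rule bexI[of _ "\<lambda>_. ?c"], blast+)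
  next
    case False
    then show ?thesis
      using affine_unit[OF False c] c by - (rule bexI[of _ ?f], rule bexI[of _ ?f], auto)
  qed
next
  fix A B :: "'k mat" and d f f' :: "'k vec \<Rightarrow> 'k vec"
  assume A: "A \<in> carrier (upper_triangular_monoid (Suc m))"
    and B: "B \<in> carrier (upper_triangular_monoid (Suc m))"
    and lead: "leading_block m A = leading_block m B"
    and E: "\<forall>z\<in>carrier_vec m. f z = A $$ (m, m) \<cdot>\<^sub>v z +
        \<one>\<^bsub>upper_triangular_monoid m\<^esub> *\<^sub>v last_column m A"
      "\<forall>z\<in>carrier_vec m. f' z = B $$ (m, m) \<cdot>\<^sub>v z +
        \<one>\<^bsub>upper_triangular_monoid m\<^esub> *\<^sub>v last_column m B"
    and ff: "\<And>x. x \<in> carrier_vec m \<Longrightarrow> f x = f' x"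
  have "A $$ (m, m) = B $$ (m, m) \<and> last_column m A = last_column m B"
    by (rule smult_add_eqD[OF m]) (use E ff in \<open>auto simp: upper_triangular_monoid_def\<close>)
  then show "A = B"
    using eq_by_blocks[OF A B lead] by simp
qed (auto simp: affine_mult affine_one affine_unit_closed affine_unit_surj leading_block_hom
    intro: monoid_units_of monoid_affine_scaling monoid_upper_triangular_monoid)

section \<open>The base case of two by two matrices\<close>

lemma mult_mat_vec_1:
  fixes A :: "'k::field mat"
  assumes "A \<in> carrier_mat 1 1" "v \<in> carrier_vec 1"
  shows "A *\<^sub>v v = A $$ (0, 0) \<cdot>\<^sub>v v"
  using assms by (intro eq_vecI) (auto simp: scalar_prod_def)

lemma unit_mat_1:
  fixes a :: "'k::field"
  assumes "a \<noteq> 0"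
  shows "mat 1 1 (\<lambda>_. a) \<in> carrier (units_of (upper_triangular_monoid 1))"
proof -
  have inv: "mat 1 1 (\<lambda>_. c) * mat 1 1 (\<lambda>_. d) = (1\<^sub>m 1 :: 'k mat)" if "c * d = 1" for c d
    by (rule eq_matI) (simp_all add: scalar_prod_def that)
  have closed: "mat 1 1 (\<lambda>_. b) \<in> carrier (upper_triangular_monoid 1)" for b :: 'k
    by (simp add: upper_triangular_carrier)
  show ?thesis
    unfolding units_of_def Units_def partial_object.simps mem_Collect_eq
    by (intro conjI closed bexI[of _ "mat 1 1 (\<lambda>_. 1 / a)"])
      (use assms in \<open>simp_all add: inv del: One_nat_def\<close>)
qed

text \<open>\<open>U1\<close> records whether a scalar is nonzero, conjunction reflecting the
  absence of zero divisors in a field. The covering is the projection to coordinate 0, which exists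
  since \<open>n > 0\<close>.\<close>

lemma covering_U1_power:
  assumes "n > 0"
  shows "covering (\<lambda>v q. v \<in> carrier (direct_power U1 n) \<and> q = v 0) (direct_power U1 n) U1"
proof
  fix q :: bool
  show "\<exists>v. v \<in> carrier (direct_power U1 n) \<and> q = v 0"
    using assms by (intro exI[of _ "\<lambda>i\<in>{..<n}. q"]) (simp add: direct_power_def U1_def)
qed (use assms in \<open>simp_all add: direct_power_def U1_def\<close>)

abbreviation (input) base_group :: "nat \<Rightarrow> (('k::field vec \<Rightarrow> 'k vec) \<times> (nat \<Rightarrow> 'k mat)) monoid" where
  "base_group n \<equiv> units_of (affine_scaling 1) \<times>\<times> direct_power (units_of (upper_triangular_monoid 1)) n"

lemma monoid_base_group: "monoid (base_group n)"
  by (intro DirProd_monoid monoid_direct_power monoid_units_of monoid_affine_scaling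
      monoid_upper_triangular_monoid)

text \<open>Coordinate 0 of the direct power is the register for the multiplier of the projective
  form; it holds a matrix of size one, hence the entry access.\<close>

definition scalar_part :: "('a \<times> (nat \<Rightarrow> 'k mat)) \<Rightarrow> 'k" where
  "scalar_part d = snd d 0 $$ (0, 0)"

lemma scalar_part_one: "n > 0 \<Longrightarrow> scalar_part \<one>\<^bsub>base_group n\<^esub> = 1"
  by (simp add: scalar_part_def direct_power_def units_of_def)

lemma scalar_part_mult:
  assumes n: "n > 0" and "d \<in> carrier (base_group n)" "d' \<in> carrier (base_group n)"
  shows "scalar_part (d \<otimes>\<^bsub>base_group n\<^esub> d') = scalar_part d * scalar_part d'"
proof -
  have "snd d 0 \<in> carrier_mat 1 1" "snd d' 0 \<in> carrier_mat 1 1"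
    using assms by (auto simp: direct_power_def units_of_def Units_def upper_triangular_carrier
        dest!: PiE_mem[where x = 0])
  then show ?thesis
    using n by (cases d; cases d')
      (simp add: scalar_part_def direct_power_def units_of_def scalar_prod_def)
qed

lemma top_left_mult:
  fixes A B :: "'k::field mat"
  assumes "A \<in> carrier (upper_triangular_monoid (Suc 1))"
    and "B \<in> carrier (upper_triangular_monoid (Suc 1))"
  shows "(A * B) $$ (0, 0) = A $$ (0, 0) * B $$ (0, 0)"
  using assms index_mult_Suc[of A 1 B 0 0] by (simp add: upper_triangular_carrier)

declare One_nat_def [simp del]

text \<open>The state after a product of matrices with top row \<open>(p, v)\<close> is kept in the projective form
  \<open>p (1, w)\<close> while \<open>p \<noteq> 0\<close>. A matrix \<open>((a, c), (0, b))\<close> then acts by \<open>w \<mapsto> w b/a + c/a\<close> and multiplies the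
  scalar by \<open>a\<close>; this does not depend on \<open>p\<close>, which is why \<open>AS\<^sub>1\<^sup>*\<close> and \<open>T\<^sub>1\<^sup>*\<close> need only see
  whether \<open>p\<close> vanishes. When \<open>p\<close> becomes or already is \<open>0\<close>, the scalar is frozen and only its product
  with \<open>w\<close> remains meaningful.\<close>

lemma covering_base:
  assumes n: "n > 0"
  shows "\<exists>R. covering R (wreath (tilde (carrier_vec 1 :: 'k vec set))
    (wreath (base_group n :: (('k vec \<Rightarrow> 'k vec) \<times> (nat \<Rightarrow> 'k mat)) monoid) (direct_power U1 n)))
    (upper_triangular_monoid (Suc 1) :: 'k::field mat monoid)"
\<comment> \<open>While \<open>q\<close> holds, the row \<open>(1, z)\<close> goes to
  \<open>(a, b z + c)\<close>, and \<open>E\<close> factors the second entry as multiplier times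
  \<open>f z\<close>, the multiplier being \<open>a\<close> unless \<open>a\<close> is zero. When
  \<open>q\<close> fails, the translation disappears and only the product of multiplier and
  \<open>f z\<close> is prescribed, as \<open>b z\<close>.\<close>
proof (rule covering_tilde_wreath[OF covering_U1_power[OF n], where act = fst and
    p = "\<lambda>A. A $$ (0, 0) \<noteq> 0" and
    E = "\<lambda>q A d f. (q \<longrightarrow> A $$ (0, 0) \<noteq> 0 \<longrightarrow> scalar_part d = A $$ (0, 0)) \<and>
      (\<forall>z\<in>carrier_vec 1. scalar_part d \<cdot>\<^sub>v f z =
        A $$ (1, 1) \<cdot>\<^sub>v z + (if q then last_column 1 A else 0\<^sub>v 1))"])
  show "monoid (base_group n :: (('k vec \<Rightarrow> 'k vec) \<times> (nat \<Rightarrow> 'k mat)) monoid)"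
    by (rule monoid_base_group)
next
  fix d :: "('k vec \<Rightarrow> 'k vec) \<times> (nat \<Rightarrow> 'k mat)" and x :: "'k vec"
  assume "d \<in> carrier (base_group n)" "x \<in> carrier_vec 1"
  then show "fst d x \<in> carrier_vec 1" "\<exists>y\<in>carrier_vec 1. fst d y = x"
    using affine_unit_closed affine_unit_surj by auto
next
  fix x :: "'k vec"
  assume "x \<in> carrier_vec 1"
  then show "fst \<one>\<^bsub>base_group n\<^esub> x = x"
    by (simp add: affine_one)
next
  fix c d :: "('k vec \<Rightarrow> 'k vec) \<times> (nat \<Rightarrow> 'k mat)" and x :: "'k vec"
  assume "x \<in> carrier_vec 1"
  then show "fst (c \<otimes>\<^bsub>base_group n\<^esub> d) x = fst d (fst c x)"
    by (cases c, cases d) (simp add: affine_mult)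
next
  show "(\<lambda>A. A $$ (0, 0) \<noteq> 0) \<in> hom (upper_triangular_monoid (Suc 1) :: 'k mat monoid) U1"
    by (auto simp: hom_def U1_def top_left_mult[unfolded Suc_1])
next
  fix q
  have "last_column 1 (1\<^sub>m 2) = (0\<^sub>v 1 :: 'k vec)"
    by (rule eq_vecI) (auto simp: last_column_def)
  then show "(q \<longrightarrow> \<one>\<^bsub>upper_triangular_monoid (Suc 1)\<^esub> $$ (0, 0) \<noteq> (0 :: 'k) \<longrightarrow>
      scalar_part \<one>\<^bsub>base_group n\<^esub> = \<one>\<^bsub>upper_triangular_monoid (Suc 1)\<^esub> $$ (0, 0)) \<and>
      (\<forall>z\<in>carrier_vec 1. scalar_part \<one>\<^bsub>base_group n\<^esub> \<cdot>\<^sub>v z =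
        (\<one>\<^bsub>upper_triangular_monoid (Suc 1)\<^esub> $$ (1, 1) :: 'k) \<cdot>\<^sub>v z +
        (if q then last_column 1 \<one>\<^bsub>upper_triangular_monoid (Suc 1)\<^esub> else 0\<^sub>v 1))"
    unfolding scalar_part_one[OF n] upper_triangular_one Suc_1 by auto
next
  fix q and A B :: "'k mat" and d d' :: "('k vec \<Rightarrow> 'k vec) \<times> (nat \<Rightarrow> 'k mat)"
    and f f' :: "'k vec \<Rightarrow> 'k vec"
  assume A: "A \<in> carrier (upper_triangular_monoid (Suc 1))"
    and B: "B \<in> carrier (upper_triangular_monoid (Suc 1))"
    and d: "d \<in> carrier (base_group n)" "d' \<in> carrier (base_group n)"
    and f: "f \<in> carrier_vec 1 \<rightarrow> carrier_vec 1" "f' \<in> carrier_vec 1 \<rightarrow> carrier_vec 1"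
    and E: "(q \<longrightarrow> A $$ (0, 0) \<noteq> 0 \<longrightarrow> scalar_part d = A $$ (0, 0)) \<and>
      (\<forall>z\<in>carrier_vec 1. scalar_part d \<cdot>\<^sub>v f z =
        A $$ (1, 1) \<cdot>\<^sub>v z + (if q then last_column 1 A else 0\<^sub>v 1))"
      "(q \<otimes>\<^bsub>U1\<^esub> (A $$ (0, 0) \<noteq> 0) \<longrightarrow> B $$ (0, 0) \<noteq> 0 \<longrightarrow> scalar_part d' = B $$ (0, 0)) \<and>
      (\<forall>z\<in>carrier_vec 1. scalar_part d' \<cdot>\<^sub>v f' z = B $$ (1, 1) \<cdot>\<^sub>v z +
        (if q \<otimes>\<^bsub>U1\<^esub> (A $$ (0, 0) \<noteq> 0) then last_column 1 B else 0\<^sub>v 1))"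
  let ?a = "A $$ (0, 0)"
  let ?k = "scalar_part d" and ?k' = "scalar_part d'"
  \<comment> \<open>The leading block has size one, so it acts on the last column as the scalar
    \<open>?a\<close>.\<close>
  have "leading_block 1 A *\<^sub>v last_column 1 B = leading_block 1 A $$ (0, 0) \<cdot>\<^sub>v last_column 1 B"
    by (rule mult_mat_vec_1) simp_all
  then have lc: "last_column 1 (A * B) =
      ?a \<cdot>\<^sub>v last_column 1 B + B $$ (1, 1) \<cdot>\<^sub>v last_column 1 A"
    using last_column_mult[OF A B] by (simp add: leading_block_def)
  have c0: "(A * B) $$ (0, 0) = ?a * B $$ (0, 0)"
    by (rule top_left_mult[OF A B])
  have "(?k * ?k') \<cdot>\<^sub>v f' (f z) = (A * B) $$ (1, 1) \<cdot>\<^sub>v z +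
      (if q then last_column 1 (A * B) else 0\<^sub>v 1)" if z: "z \<in> carrier_vec 1" for z
  proof -
    have lcs: "last_column 1 A \<in> carrier_vec 1" "last_column 1 B \<in> carrier_vec 1"
      by simp_all
    have fz: "f z \<in> carrier_vec 1"
      using f z by auto
    have "(?k * ?k') \<cdot>\<^sub>v f' (f z) = ?k \<cdot>\<^sub>v (?k' \<cdot>\<^sub>v f' (f z))"
      by (simp add: smult_smult_assoc)
    also have "\<dots> = ?k \<cdot>\<^sub>v (B $$ (1, 1) \<cdot>\<^sub>v f z +
        (if q \<and> ?a \<noteq> 0 then last_column 1 B else 0\<^sub>v 1))"
      using E(2) fz by (simp add: U1_def)
    also have "\<dots> = B $$ (1, 1) \<cdot>\<^sub>v (?k \<cdot>\<^sub>v f z) +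
        ?k \<cdot>\<^sub>v (if q \<and> ?a \<noteq> 0 then last_column 1 B else 0\<^sub>v 1)"
      using fz lcs by (auto intro!: eq_vecI simp: algebra_simps)
    also have "\<dots> = B $$ (1, 1) \<cdot>\<^sub>v (A $$ (1, 1) \<cdot>\<^sub>v z + (if q then last_column 1 A else 0\<^sub>v 1)) +
        ?a \<cdot>\<^sub>v (if q then last_column 1 B else 0\<^sub>v 1)"
    proof -
      \<comment> \<open>If \<open>q\<close> holds and \<open>?a\<close> is nonzero, the multiplier
        is \<open>?a\<close>. Otherwise both sides vanish, so the freedom in the multiplier does no
        harm.\<close>
      have "?k \<cdot>\<^sub>v (if q \<and> ?a \<noteq> 0 then last_column 1 B else 0\<^sub>v 1) =
          ?a \<cdot>\<^sub>v (if q then last_column 1 B else 0\<^sub>v 1)"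
        using E(1) lcs by (auto intro!: eq_vecI)
      then show ?thesis
        using E(1) z by simp
    qed
    also have "\<dots> = (A * B) $$ (1, 1) \<cdot>\<^sub>v z + (if q then last_column 1 (A * B) else 0\<^sub>v 1)"
      using z lcs unfolding lc corner_mult[OF A B]
      by (auto intro!: eq_vecI simp: algebra_simps)
    finally show ?thesis .
  qed
  \<comment> \<open>A nonzero product forces both top left entries to be nonzero, so
    \<open>q\<close> is passed on to the second factor and both multipliers are the true
    entries.\<close>
  moreover have "?k * ?k' = (A * B) $$ (0, 0)" if "q" "(A * B) $$ (0, 0) \<noteq> 0"
    using E that by (simp add: c0 U1_def)
  ultimately show "(q \<longrightarrow> (A \<otimes>\<^bsub>upper_triangular_monoid (Suc 1)\<^esub> B) $$ (0, 0) \<noteq> 0 \<longrightarrow>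
      scalar_part (d \<otimes>\<^bsub>base_group n\<^esub> d') = (A \<otimes>\<^bsub>upper_triangular_monoid (Suc 1)\<^esub> B) $$ (0, 0)) \<and>
      (\<forall>z\<in>carrier_vec 1. scalar_part (d \<otimes>\<^bsub>base_group n\<^esub> d') \<cdot>\<^sub>v f' (f z) =
        (A \<otimes>\<^bsub>upper_triangular_monoid (Suc 1)\<^esub> B) $$ (1, 1) \<cdot>\<^sub>v z +
        (if q then last_column 1 (A \<otimes>\<^bsub>upper_triangular_monoid (Suc 1)\<^esub> B) else 0\<^sub>v 1))"
    unfolding scalar_part_mult[OF n d] upper_triangular_mult by blast
next
  fix q and A :: "'k mat"
  \<comment> \<open>The multiplier must be invertible: it is the top left entry where
    \<open>E\<close> prescribes this, and the default 1 freezes the scalar otherwise.\<close>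
  define k where "k = (if q \<and> A $$ (0, 0) \<noteq> 0 then A $$ (0, 0) else 1)"
  have k: "k \<noteq> 0" by (simp add: k_def)
  define c where "c = (if q then last_column 1 A else 0\<^sub>v 1)"
  have c: "c \<in> carrier_vec 1" by (simp add: c_def)
  define f where "f = (\<lambda>z\<in>carrier_vec 1. (A $$ (1, 1) / k) \<cdot>\<^sub>v z + (1 / k) \<cdot>\<^sub>v c)"
  \<comment> \<open>For a zero corner \<open>f\<close> is constant and \<open>f\<close> itself is no
    unit, so the group part is set to the identity.\<close>
  define g where "g = (if A $$ (1, 1) = 0 then \<one>\<^bsub>units_of (affine_scaling 1)\<^esub> else f)"
  define d where "d = (g, \<lambda>i\<in>{..<n}. mat 1 1 (\<lambda>_. k))"
  have f: "f z = (A $$ (1, 1) / k) \<cdot>\<^sub>v z + (1 / k) \<cdot>\<^sub>v c" if "z \<in> carrier_vec 1" for z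
    using that by (simp add: f_def)
  have sd: "scalar_part d = k"
    using n by (simp add: d_def scalar_part_def)
  have g: "g \<in> carrier (units_of (affine_scaling 1))"
    using affine_unit[of "A $$ (1, 1) / k" "(1 / k) \<cdot>\<^sub>v c" 1] k c
      monoid.one_closed[OF monoid_units_of[OF monoid_affine_scaling]]
    by (auto simp: g_def f_def)
  have "d \<in> carrier (base_group n)"
    unfolding d_def using g unit_mat_1[OF k] by (simp add: direct_power_def)
  moreover have "f \<in> carrier_vec 1 \<rightarrow> carrier_vec 1"
    using c by (auto simp: f_def)
  moreover have "k \<cdot>\<^sub>v f z = A $$ (1, 1) \<cdot>\<^sub>v z + c" if "z \<in> carrier_vec 1" for z
    unfolding f[OF that] using that c k by (intro eq_vecI) (auto simp: field_simps)
  moreover have "(\<forall>x\<in>carrier_vec 1. f x = fst d x) \<or> (\<exists>c\<in>carrier_vec 1. \<forall>x\<in>carrier_vec 1. f x = c)"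
  proof (cases "A $$ (1, 1) = 0")
    case True
    have "f x = (1 / k) \<cdot>\<^sub>v c" if "x \<in> carrier_vec 1" for x
      unfolding f[OF that] using that c True by (intro eq_vecI) auto
    then show ?thesis using c by (intro disjI2 bexI[of _ "(1 / k) \<cdot>\<^sub>v c"]) auto
  qed (simp add: d_def g_def)
  ultimately show "\<exists>d\<in>carrier (base_group n). \<exists>f\<in>carrier_vec 1 \<rightarrow> carrier_vec 1.
      ((q \<longrightarrow> A $$ (0, 0) \<noteq> 0 \<longrightarrow> scalar_part d = A $$ (0, 0)) \<and>
      (\<forall>z\<in>carrier_vec 1. scalar_part d \<cdot>\<^sub>v f z =
        A $$ (1, 1) \<cdot>\<^sub>v z + (if q then last_column 1 A else 0\<^sub>v 1))) \<and>
      ((\<forall>x\<in>carrier_vec 1. f x = fst d x) \<or> (\<exists>c\<in>carrier_vec 1. \<forall>x\<in>carrier_vec 1. f x = c))"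
    by (intro bexI[of _ d] bexI[of _ f]) (simp_all add: sd flip: c_def, simp add: k_def)
next
  fix A B :: "'k mat" and d :: "('k vec \<Rightarrow> 'k vec) \<times> (nat \<Rightarrow> 'k mat)"
    and f f' :: "'k vec \<Rightarrow> 'k vec"
  assume A: "A \<in> carrier (upper_triangular_monoid (Suc 1))"
    and B: "B \<in> carrier (upper_triangular_monoid (Suc 1))"
    and p: "(A $$ (0, 0) \<noteq> 0) = (B $$ (0, 0) \<noteq> 0)"
    and E: "(\<one>\<^bsub>U1\<^esub> \<longrightarrow> A $$ (0, 0) \<noteq> 0 \<longrightarrow> scalar_part d = A $$ (0, 0)) \<and>
      (\<forall>z\<in>carrier_vec 1. scalar_part d \<cdot>\<^sub>v f z =
        A $$ (1, 1) \<cdot>\<^sub>v z + (if \<one>\<^bsub>U1\<^esub> then last_column 1 A else 0\<^sub>v 1))"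
      "(\<one>\<^bsub>U1\<^esub> \<longrightarrow> B $$ (0, 0) \<noteq> 0 \<longrightarrow> scalar_part d = B $$ (0, 0)) \<and>
      (\<forall>z\<in>carrier_vec 1. scalar_part d \<cdot>\<^sub>v f' z =
        B $$ (1, 1) \<cdot>\<^sub>v z + (if \<one>\<^bsub>U1\<^esub> then last_column 1 B else 0\<^sub>v 1))"
    and ff: "\<And>x. x \<in> carrier_vec 1 \<Longrightarrow> f x = f' x"
  have one: "\<one>\<^bsub>U1\<^esub>"
    by (simp add: U1_def)
  have "A $$ (1, 1) = B $$ (1, 1) \<and> last_column 1 A = last_column 1 B"
  proof (rule smult_add_eqD[of 1])
    fix z :: "'k vec" assume z: "z \<in> carrier_vec 1"
    show "A $$ (1, 1) \<cdot>\<^sub>v z + last_column 1 A = B $$ (1, 1) \<cdot>\<^sub>v z + last_column 1 B"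
      using E z ff[OF z] one by auto
  qed simp_all
  \<comment> \<open>By \<open>p\<close> the two entries vanish together; if they do not vanish, both
    equal the multiplier of the common \<open>d\<close>.\<close>
  moreover have "A $$ (0, 0) = B $$ (0, 0)"
    using E p one by auto
  then have "leading_block 1 A = leading_block 1 B"
    by (intro eq_matI) (auto simp: leading_block_def)
  ultimately show "A = B"
    using eq_by_blocks[OF A B] by simp
next
  show "(\<one>\<^bsub>upper_triangular_monoid (Suc 1)\<^esub> $$ (0, 0) \<noteq> (0 :: 'k)) = \<one>\<^bsub>U1\<^esub>"
    by (simp add: U1_def)
qed (simp_all add: monoid_U1 monoid_direct_power monoid_upper_triangular_monoid)

section \<open>Induction along the iterated wreath product\<close>

text \<open>The direct powers at the bottom have size \<open>N\<close>, kept apart from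
  \<open>n\<close>: they stay fixed while the induction adds layers on top.\<close>

lemma covering_iterated_wreath:
  fixes W :: "'w monoid"
  assumes "n \<ge> 2" "N > 0"
    and "iterated_wreath
           (concat (map (\<lambda>m. [tilde (carrier_vec m :: 'k::field vec set), units_of (affine_scaling m)])
                        (rev [2..<n]))
            @ [tilde (carrier_vec 1)])
           (wreath (base_group N :: (('k vec \<Rightarrow> 'k vec) \<times> (nat \<Rightarrow> 'k mat)) monoid) (direct_power U1 N)) W"
  shows "\<exists>R. covering R W (upper_triangular_monoid n :: 'k mat monoid)"
  using assms(1,3)
proof (induction n arbitrary: W rule: dec_induct)
  case base
  then obtain V :: "'w monoid" where V: "monoid V"
      "V \<cong> wreath (base_group N :: (('k vec \<Rightarrow> 'k vec) \<times> (nat \<Rightarrow> 'k mat)) monoid) (direct_power U1 N)"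
    and W: "monoid W" "W \<cong> wreath (tilde (carrier_vec 1 :: 'k vec set)) V"
    by auto
  have "W \<cong> wreath (tilde (carrier_vec 1 :: 'k vec set))
      (wreath (base_group N :: (('k vec \<Rightarrow> 'k vec) \<times> (nat \<Rightarrow> 'k mat)) monoid) (direct_power U1 N))"
    using iso_trans[OF W(2) wreath_cong[OF V(2,1)]] .
  moreover obtain R where "covering R (wreath (tilde (carrier_vec 1 :: 'k vec set))
      (wreath (base_group N :: (('k vec \<Rightarrow> 'k vec) \<times> (nat \<Rightarrow> 'k mat)) monoid) (direct_power U1 N))) (upper_triangular_monoid (Suc 1) :: 'k mat monoid)"
    using covering_base[OF assms(2)] by blast
  ultimately show ?case
    using covering_iso W(1) monoid_wreath monoid_tilde monoid_base_group monoid_direct_power monoid_U1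
    unfolding Suc_1 by metis
next
  case (step m)
  \<comment> \<open>\<open>rev [2..<Suc m]\<close> starts with \<open>m\<close>, so exactly two
    layers lie above the product \<open>V\<close> for size \<open>m\<close>: the units give
    \<open>V1\<close>, and the tilde monoid gives \<open>W\<close>.\<close>
  then obtain V1 V :: "'w monoid" where
    V: "iterated_wreath
           (concat (map (\<lambda>m. [tilde (carrier_vec m :: 'k vec set), units_of (affine_scaling m)])
                        (rev [2..<m])) @ [tilde (carrier_vec 1)])
           (wreath (base_group N :: (('k vec \<Rightarrow> 'k vec) \<times> (nat \<Rightarrow> 'k mat)) monoid) (direct_power U1 N)) V"
    and V1: "monoid V1" "V1 \<cong> wreath (units_of (affine_scaling m) :: ('k vec \<Rightarrow> 'k vec) monoid) V"
    and W: "monoid W" "W \<cong> wreath (tilde (carrier_vec m :: 'k vec set)) V1"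
    by auto
  obtain R where "covering R V (upper_triangular_monoid m :: 'k mat monoid)"
    using step.IH[OF V] by blast
  then obtain R' where "covering R' (wreath (tilde (carrier_vec m :: 'k vec set))
      (wreath (units_of (affine_scaling m :: ('k vec \<Rightarrow> 'k vec) monoid)) V)) (upper_triangular_monoid (Suc m) :: 'k mat monoid)"
    using covering_step[of R V m] iterated_wreath_monoid[OF V] step.hyps by auto
  moreover have "W \<cong> wreath (tilde (carrier_vec m :: 'k vec set))
      (wreath (units_of (affine_scaling m :: ('k vec \<Rightarrow> 'k vec) monoid)) V)"
    using iso_trans[OF W(2) wreath_cong[OF V1(2,1)]] .
  moreover have "monoid (wreath (tilde (carrier_vec m :: 'k vec set))
      (wreath (units_of (affine_scaling m) :: ('k vec \<Rightarrow> 'k vec) monoid) V))"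
    by (intro monoid_wreath monoid_tilde monoid_units_of monoid_affine_scaling
        iterated_wreath_monoid[OF V])
  ultimately show ?case
    using covering_iso W(1) by metis
qed

theorem theorem4p4:
  fixes n :: nat and W :: "'w monoid"
  assumes "n \<ge> 2"
    and "iterated_wreath
           (concat (map (\<lambda>m. [tilde (carrier_vec m :: 'k::field vec set), units_of (affine_scaling m)])
                        (rev [2..<n]))
            @ [tilde (carrier_vec 1)])
           (wreath
              (units_of (affine_scaling 1 :: ('k vec \<Rightarrow> 'k vec) monoid)
               \<times>\<times> direct_power (units_of (upper_triangular_monoid 1 :: 'k mat monoid)) n)
              (direct_power U1 n))
           W"
  shows "divides (upper_triangular_monoid n :: 'k mat monoid) W"
  using covering_iterated_wreath[OF assms(1) _ assms(2)] covering_divides assms(1) by auto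

end
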